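(* Let $\widetilde{\mathcal{H}}$ be the sublinear Hilbert operator $\widetilde{\mathcal{H}}(f)(z)=\int_0^1\frac{|f(t)|}{1-tz}\,dt$. Then: (i) If $p>1$, then $\widetilde{\mathcal{H}}:H^p\to H^p$ is bounded. (ii) If $p>1$ and $-1<\alpha<p-2$, then $\widetilde{\mathcal{H}}:A^p_\alpha\to A^p_\alpha$ is bounded. (iii) If $p>1$ and $p-2<\alpha\le p-1$, then $\widetilde{\mathcal{H}}:\mathcal{D}^p_\alpha\to\mathcal{D}^p_\alpha$ is bounded.
   Context: $\mathbb{D}$ is the open unit disc and $dA=\frac1\pi dx\,dy$; here $1<p<\infty$ and $\alpha>-1$. $H^p$ is the Hardy space of analytic $f$ in $\mathbb{D}$ with $\|f\|_{H^p}=\sup_{0<r<1}\left(\frac1{2\pi}\int_0^{2\pi}|f(re^{it})|^p\,dt\right)^{1/p}<\infty$. The weighted Bergman space $A^p_\alpha$ consists of analytic $f$ in $\mathbb{D}$ with $\|f\|_{A^p_\alpha}=\left((\alpha+1)\int_{\mathbb{D}}|f(z)|^p(1-|z|^2)^\alpha\,dA(z)\right)^{1/p}<\infty$. The Dirichlet type space $\mathcal{D}^p_\alpha$ consists of analytic $f$ in $\mathbb{D}$ with $\|f\|_{\mathcal{D}^p_\alpha}^p=|f(0)|^p+\|f'\|_{A^p_\alpha}^p<\infty$. $\widetilde{\mathcal{H}}(f)$ is defined, and analytic in $\mathbb{D}$, for every analytic $f$ in $\mathbb{D}$ with $\int_0^1|f(t)|\,dt<\infty$, which holds for all functions in each of the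 spaces above in the indicated parameter ranges. For this (non-linear) operator, "bounded on $X$" means that there is a constant $C>0$ such that $\widetilde{\mathcal{H}}(f)\in X$ and $\|\widetilde{\mathcal{H}}(f)\|_X\le C\|f\|_X$ for all $f\in X$. *)

theory Defs
  imports "HOL-Complex_Analysis.Complex_Analysis"
begin

(* Norms are real-valued, and "the norm is finite" is expressed in the space
   definitions: by boundedness of the integral means, respectively by Lebesgue
   integrability of the (nonnegative, continuous on the disc) integrand.
   Outside these spaces the value of a norm has no meaning. The unit disc is
   "ball 0 1"; no definition depends on the values of f outside it. *)

definition integral_mean :: "real \<Rightarrow> real \<Rightarrow> (complex \<Rightarrow> complex) \<Rightarrow> real" where
  "integral_mean p r f =
     (1 / (2 * pi) * (LINT t:{0..2*pi}|lborel. cmod (f (rcis r t)) powr p)) powr (1 / p)"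

definition hardy_norm :: "real \<Rightarrow> (complex \<Rightarrow> complex) \<Rightarrow> real" where
  "hardy_norm p f = (SUP r\<in>{0<..<1}. integral_mean p r f)"

definition hardy_space :: "real \<Rightarrow> (complex \<Rightarrow> complex) set" where
  "hardy_space p =
     {f. f holomorphic_on ball 0 1 \<and> bdd_above ((\<lambda>r. integral_mean p r f) ` {0<..<1})}"

(* The factor 1 / pi normalises the area measure: dA = (1 / pi) dx dy. *)

definition bergman_norm :: "real \<Rightarrow> real \<Rightarrow> (complex \<Rightarrow> complex) \<Rightarrow> real" where
  "bergman_norm p \<alpha> f =
     ((\<alpha> + 1) * (1 / pi *
        (LINT z:ball 0 1|lborel. cmod (f z) powr p * (1 - (cmod z)\<^sup>2) powr \<alpha>))) powr (1 / p)"

definition bergman_space :: "real \<Rightarrow> real \<Rightarrow> (complex \<Rightarrow> complex) set" where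
  "bergman_space p \<alpha> =
     {f. f holomorphic_on ball 0 1 \<and>
         set_integrable lborel (ball 0 1)
           (\<lambda>z. cmod (f z) powr p * (1 - (cmod z)\<^sup>2) powr \<alpha>)}"

definition dirichlet_norm :: "real \<Rightarrow> real \<Rightarrow> (complex \<Rightarrow> complex) \<Rightarrow> real" where
  "dirichlet_norm p \<alpha> f =
     (cmod (f 0) powr p + bergman_norm p \<alpha> (deriv f) powr p) powr (1 / p)"

definition dirichlet_space :: "real \<Rightarrow> real \<Rightarrow> (complex \<Rightarrow> complex) set" where
  "dirichlet_space p \<alpha> =
     {f. f holomorphic_on ball 0 1 \<and> deriv f \<in> bergman_space p \<alpha>}"

(* The point t = 1 is left out so that f is only evaluated inside the disc. *)

definition sublinear_hilbert :: "(complex \<Rightarrow> complex) \<Rightarrow> complex \<Rightarrow> complex" where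
  "sublinear_hilbert f z =
     (LINT t:{0..<1}|lborel.
        complex_of_real (cmod (f (complex_of_real t))) / (1 - complex_of_real t * z))"

definition bounded_operator_on ::
  "'a set \<Rightarrow> ('a \<Rightarrow> real) \<Rightarrow> ('a \<Rightarrow> 'a) \<Rightarrow> bool" where
  "bounded_operator_on X N T \<longleftrightarrow> (\<exists>C>0. \<forall>f\<in>X. T f \<in> X \<and> N (T f) \<le> C * N f)"

end

theory Submission
  imports Defs
begin

text \<open>
  Everything is reduced to one weighted Hilbert inequality on the half line,
  \<open>\<integral> v\<^sup>g (\<integral> h(s) (s + v) powr -c ds)\<^sup>p dv \<le> C \<integral> s powr (g + p (1 - c)) h(s)\<^sup>p ds\<close> for
  \<open>-1 < g < c p - 1\<close>, which is Schur's test with power weights.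
  Write \<open>s = 1 - t\<close>. Since \<open>|1 - t r e\<^sup>i\<^sup>\<theta>|\<close> is comparable to \<open>s + (1 - r) + |\<theta>|\<close>, both the sublinear
  Hilbert operator (\<open>c = 1\<close>) and its derivative (\<open>c = 2\<close>) are dominated by the inner integral at
  \<open>v = (1 - r) + |\<theta>|\<close>, with \<open>h(s) = |f(1 - s)|\<close>, and integrating \<open>(1 - r) powr \<alpha>\<close> over the lines
  \<open>(1 - r) + |\<theta>| = v\<close> turns Bergman norms into integrals against \<open>v powr (\<alpha> + 1)\<close>.
  Conversely, Cauchy's formula on a circle together with the same inequality gives the
  Fejer--Riesz inequality, which controls the restriction of \<open>f\<close> to a radius by its circle means
  and, after integration over the circles, by its Bergman norm. For the Dirichlet type spaces the radial
  restriction of \<open>f\<close> is recovered from that of \<open>f'\<close> by Hardy's inequality, again a special case since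
  \<open>1 \<le> 2 y / (s + y)\<close> for \<open>s \<le> y\<close>.
\<close>

section \<open>Schur's test and the weighted Hilbert inequality\<close>

text \<open>The admissible \<alpha> are those for which the weighted inequality applies. On a
  Bergman space its exponent is g = \<alpha> + 1 with c = 1, and g + 1 < c p reads \<alpha> < p - 2.
  For the derivative c = 2, and the same condition becomes \<alpha> < 2 p - 2, while p - 2 <
  \<alpha> says that the weight \<open>s powr (\<alpha> + 1 - p)\<close> is integrable at 0, which
  Hardy's inequality requires on the way back from f' to f. The operator sees only |f| on the
  radius, so its non-linearity does no harm: the estimates concern nonnegative functions. A
  divergent Bochner integral has the value 0, so integrability of f along the radius must be proved
  before the operator can be handled; this too comes out of the weighted inequality, tested on a
  constant function. Finiteness being a conclusion throughout, the estimates are made with extended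
  nonnegative integrals, and where a p-th power of an integral is wanted, a real number below that
  integral takes its place.\<close>

lemma nn_integral_powr_beta_le:
  fixes q c x :: real
  assumes q: "0 < q" "q < c" and x: "0 < x"
  shows "(\<integral>\<^sup>+s\<in>{0<..}. ennreal (s powr (q - 1) * (s + x) powr - c) \<partial>lborel)
           \<le> ennreal ((1 / q + 1 / (c - q)) * x powr (q - c))"
proof -
  \<comment> \<open>The integral is cut at \<open>s = x\<close>: below,
    \<open>(s + x) powr - c\<close> is at most \<open>x powr - c\<close>; above, at most
    \<open>s powr - c\<close>. The pieces give the summands \<open>1 / q\<close> and
    \<open>1 / (c - q)\<close>.\<close>
  have A: "(\<integral>\<^sup>+s. ennreal (s powr (q - 1)) * indicator {0..x} s \<partial>lborel) = ennreal (x powr q / q)"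
    using nn_integral_has_integral_lebesgue'[OF _ has_integral_powr_from_0[of "q - 1" x]] q x by simp
  have B: "(\<integral>\<^sup>+s. ennreal (s powr (q - 1 - c)) * indicator {x..} s \<partial>lborel)
      = ennreal (x powr (q - c) / (c - q))"
    using nn_integral_has_integral_lebesgue'[OF _ has_integral_powr_to_inf[of "q - 1 - c" x]] q x
    by (simp add: field_simps minus_divide_left[symmetric] flip: minus_divide_right)
  have "(\<integral>\<^sup>+s\<in>{0<..}. ennreal (s powr (q - 1) * (s + x) powr - c) \<partial>lborel)
     \<le> (\<integral>\<^sup>+s. ennreal (x powr - c) * (ennreal (s powr (q - 1)) * indicator {0..x} s)
          + ennreal (s powr (q - 1 - c)) * indicator {x..} s \<partial>lborel)"
  proof (rule nn_integral_mono)
    fix s :: real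
    consider "s \<le> 0" | "0 < s" "s < x" | "0 < s" "x \<le> s" by linarith
    then show "ennreal (s powr (q - 1) * (s + x) powr - c) * indicator {0<..} s
      \<le> ennreal (x powr - c) * (ennreal (s powr (q - 1)) * indicator {0..x} s)
          + ennreal (s powr (q - 1 - c)) * indicator {x..} s"
    proof cases
      case 2
      have "s powr (q - 1) * (s + x) powr - c \<le> x powr - c * s powr (q - 1)"
        using 2 q by (simp add: mult.commute mult_left_mono powr_mono2')
      then show ?thesis using 2 by (simp add: ennreal_mult''[symmetric] ennreal_leI)
    next
      case 3
      have "s powr (q - 1) * (s + x) powr - c \<le> s powr (q - 1) * s powr - c"
        using 3 q x by (intro mult_left_mono powr_mono2') auto
      also have "\<dots> = s powr (q - 1 - c)" using 3 by (simp flip: powr_add)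
      finally show ?thesis using 3 by (auto intro!: add_increasing ennreal_leI)
    qed auto
  qed
  also have "\<dots> = ennreal (x powr - c) * ennreal (x powr q / q) + ennreal (x powr (q - c) / (c - q))"
    by (subst nn_integral_add) (auto simp: nn_integral_cmult A B)
  also have "\<dots> = ennreal ((1 / q + 1 / (c - q)) * x powr (q - c))"
    using q x
    by (simp add: ennreal_mult[symmetric] ennreal_plus[symmetric] distrib_right powr_diff powr_minus field_simps
             del: ennreal_plus)
  finally show ?thesis .
qed

text \<open>The convex function \<open>y powr p\<close> lies above its tangent at \<open>b\<close>;
  Young's inequality with exponents p and p / (p - 1) is exactly this.\<close>

lemma powr_tangent_le:
  fixes p b y :: real
  assumes "p > 1" "b \<ge> 0" "y \<ge> 0"
  shows "p * b powr (p - 1) * y \<le> y powr p + (p - 1) * b powr p"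
proof -
  have "y * b powr (p - 1) \<le> y powr p / p + (b powr (p - 1)) powr (p / (p - 1)) / (p / (p - 1))"
    using assms by (intro Youngs_inequality) (auto simp: field_simps)
  moreover have "(b powr (p - 1)) powr (p / (p - 1)) = b powr p" using assms by (simp add: powr_powr)
  ultimately show ?thesis using assms by (simp add: field_simps)
qed

text \<open>Integrating the tangent inequality at \<open>a / m\<close> gives Jensen's inequality without any
  powers of extended reals.\<close>

lemma nn_integral_powr_jensen:
  fixes \<phi> w :: "'a \<Rightarrow> real"
  assumes [measurable]: "\<phi> \<in> borel_measurable M" "w \<in> borel_measurable M"
    and nonneg: "\<And>x. 0 \<le> \<phi> x" "\<And>x. 0 \<le> w x"
    and p: "p > 1" and m: "m > 0" "(\<integral>\<^sup>+x. ennreal (w x) \<partial>M) \<le> ennreal m"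
    and a: "a \<ge> 0" "ennreal a \<le> (\<integral>\<^sup>+x. ennreal (\<phi> x * w x) \<partial>M)"
  shows "ennreal (a powr p) \<le> ennreal (m powr (p - 1)) * (\<integral>\<^sup>+x. ennreal (\<phi> x powr p * w x) \<partial>M)"
proof -
  \<comment> \<open>The point of tangency is a lower bound for the mean of \<phi> with respect to
    \<open>w\<close>, since \<open>a\<close> lies below the integral and \<open>m\<close> above the
    mass.\<close>
  define b where "b = a / m"
  have b: "b \<ge> 0" "b * m = a" using m a by (auto simp: b_def)
  define J where "J = (\<integral>\<^sup>+x. ennreal (\<phi> x powr p * w x) \<partial>M)"
  have bp: "b powr (p - 1) * b = b powr p" using b by (cases "b = 0") (auto simp: powr_diff)
  have "ennreal (p * b powr (p - 1) * a) = ennreal (p * b powr (p - 1)) * ennreal a"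
    using p a by (simp add: ennreal_mult)
  also have "\<dots> \<le> ennreal (p * b powr (p - 1)) * (\<integral>\<^sup>+x. ennreal (\<phi> x * w x) \<partial>M)"
    by (intro mult_left_mono a) auto
  also have "\<dots> = (\<integral>\<^sup>+x. ennreal (p * b powr (p - 1)) * ennreal (\<phi> x * w x) \<partial>M)"
    by (subst nn_integral_cmult) auto
  also have "\<dots> \<le> (\<integral>\<^sup>+x. ennreal (\<phi> x powr p * w x) + ennreal ((p - 1) * b powr p) * ennreal (w x) \<partial>M)"
  proof (rule nn_integral_mono)
    fix x
    have "p * b powr (p - 1) * \<phi> x * w x \<le> (\<phi> x powr p + (p - 1) * b powr p) * w x"
      by (intro mult_right_mono powr_tangent_le p b nonneg)
    then show "ennreal (p * b powr (p - 1)) * ennreal (\<phi> x * w x)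
        \<le> ennreal (\<phi> x powr p * w x) + ennreal ((p - 1) * b powr p) * ennreal (w x)"
      using p nonneg[of x]
      by (simp add: ennreal_mult[symmetric] ennreal_plus[symmetric] distrib_right mult.assoc ennreal_leI
               del: ennreal_plus)
  qed
  also have "\<dots> = J + ennreal ((p - 1) * b powr p) * (\<integral>\<^sup>+x. ennreal (w x) \<partial>M)"
    by (subst nn_integral_add) (auto simp: nn_integral_cmult J_def)
  also have "\<dots> \<le> J + ennreal ((p - 1) * b powr p) * ennreal m"
    by (intro add_left_mono mult_left_mono m) auto
  also have "ennreal ((p - 1) * b powr p) * ennreal m = ennreal ((p - 1) * b powr (p - 1) * a)"
    using p m b by (simp add: ennreal_mult[symmetric] bp[symmetric] b(2)[symmetric] mult_ac)
  finally have *: "ennreal (p * b powr (p - 1) * a) \<le> J + ennreal ((p - 1) * b powr (p - 1) * a)" .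
  \<comment> \<open>The term with the factor \<open>p - 1\<close> is finite, so it cancels from both
    sides when \<open>J\<close> is finite; for infinite \<open>J\<close> the claim is
    trivial.\<close>
  have J: "ennreal (b powr (p - 1) * a) \<le> J"
  proof (cases J)
    case (real j)
    with * p a have "p * b powr (p - 1) * a \<le> j + (p - 1) * b powr (p - 1) * a"
      by (simp add: ennreal_plus[symmetric] ennreal_le_iff del: ennreal_plus)
    then show ?thesis using real by (simp add: algebra_simps ennreal_leI)
  qed auto
  have "a powr p = m powr (p - 1) * (b powr (p - 1) * a)"
    using m a p by (cases "a = 0") (auto simp: b_def powr_divide powr_diff)
  then have "ennreal (a powr p) = ennreal (m powr (p - 1)) * ennreal (b powr (p - 1) * a)"
    using a by (simp add: ennreal_mult)
  also have "\<dots> \<le> ennreal (m powr (p - 1)) * J" by (intro mult_left_mono J) auto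
  finally show ?thesis unfolding J_def .
qed

text \<open>Schur's test with power weights; the exponent \<open>q\<close> makes both Schur integrals the same
  beta integral.\<close>

lemma weighted_hilbert_inequality:
  fixes p c g :: real
  assumes p: "p > 1" and g: "g > -1" "g + 1 < c * p"
  shows "\<exists>C>0. \<forall>h A. h \<in> borel_measurable borel \<longrightarrow> (\<forall>s. 0 \<le> h s) \<longrightarrow> (\<forall>v>0. 0 \<le> A v) \<longrightarrow>
    (\<forall>v>0. ennreal (A v) \<le> (\<integral>\<^sup>+s\<in>{0<..}. ennreal (h s * (s + v) powr - c) \<partial>lborel)) \<longrightarrow>
    (\<integral>\<^sup>+v\<in>{0<..}. ennreal (A v powr p * v powr g) \<partial>lborel)
      \<le> ennreal C * (\<integral>\<^sup>+s\<in>{0<..}. ennreal (h s powr p * s powr (g + p * (1 - c))) \<partial>lborel)"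
proof -
  \<comment> \<open>The relation q p = g + 1 turns the power g - q (p - 1) of v left over by Jensen
    into q - 1, and the hypotheses on g say exactly 0 < q < c.\<close>
  define q where "q = (g + 1) / p"
  have q: "0 < q" "q < c" using p g by (auto simp: q_def field_simps)
  have qp: "q * p = g + 1" using p by (simp add: q_def)
  \<comment> \<open>Symmetric under exchanging q and c - q, so one constant serves the integral over
    s and the one over v.\<close>
  define K where "K = 1 / q + 1 / (c - q)"
  have K: "K > 0" using q by (simp add: K_def add_pos_pos)
  show ?thesis
  proof (intro exI[of _ "K powr (p - 1) * K"] conjI allI impI)
    show "K powr (p - 1) * K > 0" using K by simp
    fix h A :: "real \<Rightarrow> real"
    assume [measurable]: "h \<in> borel_measurable borel" and h: "\<forall>s. 0 \<le> h s" and A: "\<forall>v>0. 0 \<le> A v"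
      and *: "\<forall>v>0. ennreal (A v) \<le> (\<integral>\<^sup>+s\<in>{0<..}. ennreal (h s * (s + v) powr - c) \<partial>lborel)"
    \<comment> \<open>Jensen is applied to \<open>h s * s powr m\<close> with the weight
      \<open>s powr (- m) * (s + v) powr - c\<close>, a beta integrand with exponent c - q, whose
      mass is at most \<open>K * v powr - q\<close>.\<close>
    define m where "m = 1 - c + q"
    have step: "ennreal (A v powr p) \<le> ennreal ((K * v powr - q) powr (p - 1)) *
       (\<integral>\<^sup>+s\<in>{0<..}. ennreal (h s powr p * s powr (m * (p - 1)) * (s + v) powr - c) \<partial>lborel)"
      if v: "v > 0" for v
    proof -
      let ?w = "\<lambda>s. indicator {0<..} s * (s powr (- m) * (s + v) powr - c)"
      have m: "- m = c - q - 1" by (simp add: m_def)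
      have 1: "(\<integral>\<^sup>+s. ennreal (?w s) \<partial>lborel) \<le> ennreal (K * v powr - q)"
        using nn_integral_powr_beta_le[of "c - q" c v] q v
        unfolding m by (simp add: K_def indicator_mult_ennreal mult.commute add.commute)
      have 2: "ennreal (A v) \<le> (\<integral>\<^sup>+s. ennreal (h s * s powr m * ?w s) \<partial>lborel)"
      proof -
        have eq: "h s * s powr m * ?w s = indicator {0<..} s * (h s * (s + v) powr - c)" for s
          by (auto simp: indicator_def powr_minus)
        have "(\<integral>\<^sup>+s. ennreal (h s * s powr m * ?w s) \<partial>lborel)
          = (\<integral>\<^sup>+s\<in>{0<..}. ennreal (h s * (s + v) powr - c) \<partial>lborel)"
          unfolding eq by (intro nn_integral_cong) (simp add: indicator_def)
        then show ?thesis using *[rule_format, OF v] by simp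
      qed
      have "ennreal (A v powr p) \<le> ennreal ((K * v powr - q) powr (p - 1)) *
         (\<integral>\<^sup>+s. ennreal ((h s * s powr m) powr p * ?w s) \<partial>lborel)"
        by (rule nn_integral_powr_jensen) (use 1 2 p h A K v in auto)
      also have "(\<integral>\<^sup>+s. ennreal ((h s * s powr m) powr p * ?w s) \<partial>lborel)
         = (\<integral>\<^sup>+s\<in>{0<..}. ennreal (h s powr p * s powr (m * (p - 1)) * (s + v) powr - c) \<partial>lborel)"
        using h by (intro nn_integral_cong)
          (auto simp: indicator_def powr_mult powr_powr powr_minus powr_diff algebra_simps divide_inverse)
      finally show ?thesis .
    qed
    have "(\<integral>\<^sup>+v\<in>{0<..}. ennreal (A v powr p * v powr g) \<partial>lborel)
      \<le> (\<integral>\<^sup>+v. \<integral>\<^sup>+s. ennreal (indicator {0<..} s * indicator {0<..} v * (K powr (p - 1) * h s powr p * s powr (m * (p - 1))) *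
            (v powr (q - 1) * (v + s) powr - c)) \<partial>lborel \<partial>lborel)"
    proof (intro nn_integral_mono)
      fix v :: real
      show "ennreal (A v powr p * v powr g) * indicator {0<..} v \<le> (\<integral>\<^sup>+s. ennreal (indicator {0<..} s * indicator {0<..} v * (K powr (p - 1) * h s powr p * s powr (m * (p - 1))) *
            (v powr (q - 1) * (v + s) powr - c)) \<partial>lborel)"
      proof (cases "v > 0")
        case True
        have e: "(K * v powr - q) powr (p - 1) * v powr g = K powr (p - 1) * v powr (q - 1)"
        proof -
          have "g - q * (p - 1) = q - 1" using qp by (simp add: algebra_simps)
          then have "v powr (- q * (p - 1)) * v powr g = v powr (q - 1)"
            using True by (simp flip: powr_add)
          then show ?thesis using K True by (simp add: powr_mult powr_powr)
        qed
        have "ennreal (A v powr p * v powr g) = ennreal (v powr g) * ennreal (A v powr p)"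
          by (simp add: ennreal_mult mult.commute)
        also have "\<dots> \<le> ennreal (v powr g) * (ennreal ((K * v powr - q) powr (p - 1)) *
          (\<integral>\<^sup>+s\<in>{0<..}. ennreal (h s powr p * s powr (m * (p - 1)) * (s + v) powr - c) \<partial>lborel))"
          by (intro mult_left_mono step True) auto
        also have "\<dots> = ennreal ((K * v powr - q) powr (p - 1) * v powr g) * 
          (\<integral>\<^sup>+s\<in>{0<..}. ennreal (h s powr p * s powr (m * (p - 1)) * (s + v) powr - c) \<partial>lborel)"
          by (simp add: ennreal_mult mult_ac)
        also have "\<dots> = (\<integral>\<^sup>+s. ennreal (indicator {0<..} s * indicator {0<..} v * (K powr (p - 1) * h s powr p * s powr (m * (p - 1))) *
            (v powr (q - 1) * (v + s) powr - c)) \<partial>lborel)"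
          unfolding e using True
          by (subst nn_integral_cmult[symmetric])
             (auto intro!: nn_integral_cong simp: ennreal_mult[symmetric] indicator_def mult_ac add.commute)
        finally show ?thesis using True by simp
      qed auto
    qed
    also have "\<dots> = (\<integral>\<^sup>+s. \<integral>\<^sup>+v. ennreal (indicator {0<..} s * indicator {0<..} v * (K powr (p - 1) * h s powr p * s powr (m * (p - 1))) *
            (v powr (q - 1) * (v + s) powr - c)) \<partial>lborel \<partial>lborel)"
      by (rule lborel_pair.Fubini') measurable
    also have "\<dots> \<le> (\<integral>\<^sup>+s. ennreal (K powr (p - 1) * K) * (ennreal (h s powr p * s powr (g + p * (1 - c))) * indicator {0<..} s) \<partial>lborel)"
    proof (intro nn_integral_mono)
      fix s :: real
      show "(\<integral>\<^sup>+v. ennreal (indicator {0<..} s * indicator {0<..} v * (K powr (p - 1) * h s powr p * s powr (m * (p - 1))) *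
            (v powr (q - 1) * (v + s) powr - c)) \<partial>lborel)
        \<le> ennreal (K powr (p - 1) * K) * (ennreal (h s powr p * s powr (g + p * (1 - c))) * indicator {0<..} s)"
      proof (cases "s > 0")
        case True
        let ?k = "K powr (p - 1) * h s powr p * s powr (m * (p - 1))"
        have "(\<integral>\<^sup>+v. ennreal (indicator {0<..} s * indicator {0<..} v * (K powr (p - 1) * h s powr p * s powr (m * (p - 1))) *
            (v powr (q - 1) * (v + s) powr - c)) \<partial>lborel)
          = ennreal ?k * (\<integral>\<^sup>+v\<in>{0<..}. ennreal (v powr (q - 1) * (v + s) powr - c) \<partial>lborel)"
          using True by (subst nn_integral_cmult[symmetric])
             (auto intro!: nn_integral_cong simp: ennreal_mult[symmetric] indicator_def mult_ac add.commute)
        also have "\<dots> \<le> ennreal ?k * ennreal (K * s powr (q - c))"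
          unfolding K_def by (intro mult_left_mono nn_integral_powr_beta_le q True) auto
        also have "\<dots> = ennreal (K powr (p - 1) * K * (h s powr p * (s powr (m * (p - 1)) * s powr (q - c))))"
          using K by (simp add: ennreal_mult[symmetric] mult_ac)
        also have "s powr (m * (p - 1)) * s powr (q - c) = s powr (g + p * (1 - c))"
        proof -
          have "m * (p - 1) + (q - c) = g + p * (1 - c)" using qp by (simp add: m_def algebra_simps)
          then show ?thesis using True by (simp flip: powr_add)
        qed
        finally show ?thesis using True K by (simp add: ennreal_mult)
      qed auto
    qed
    also have "\<dots> = ennreal (K powr (p - 1) * K) * (\<integral>\<^sup>+s\<in>{0<..}. ennreal (h s powr p * s powr (g + p * (1 - c))) \<partial>lborel)"
      by (rule nn_integral_cmult) measurable
    finally show "(\<integral>\<^sup>+v\<in>{0<..}. ennreal (A v powr p * v powr g) \<partial>lborel)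
      \<le> ennreal (K powr (p - 1) * K) * (\<integral>\<^sup>+s\<in>{0<..}. ennreal (h s powr p * s powr (g + p * (1 - c))) \<partial>lborel)" .
  qed
qed

section \<open>Polar coordinates on the unit disc\<close>

text \<open>Lebesgue measure is determined by its values on boxes, so comparing areas of rectangles
  suffices. This is the bridge from area integrals to iterated real ones.\<close>

lemma lborel_complex_eq:
  "(lborel :: complex measure) = distr (lborel \<Otimes>\<^sub>M lborel) borel (\<lambda>(x, y). Complex x y)"
proof (rule lborel_eqI)
  have m[measurable]: "(\<lambda>(x, y). Complex x y) \<in> borel_measurable (lborel \<Otimes>\<^sub>M lborel)"
    unfolding Complex_eq by measurable
  show "sets (distr (lborel \<Otimes>\<^sub>M lborel) borel (\<lambda>(x, y). Complex x y)) = sets borel" by simp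
  fix l u :: complex
  assume le: "\<And>b. b \<in> Basis \<Longrightarrow> l \<bullet> b \<le> u \<bullet> b"
  have le': "Re l \<le> Re u" "Im l \<le> Im u"
    using le[of 1] le[of \<i>] by (auto simp: Basis_complex_def inner_complex_def)
  have "(\<lambda>(x, y). Complex x y) -` box l u \<inter> space (lborel \<Otimes>\<^sub>M lborel)
      = {Re l<..<Re u} \<times> {Im l<..<Im u}"
    by (auto simp: box_def Basis_complex_def inner_complex_def space_pair_measure)
  then have "emeasure (distr (lborel \<Otimes>\<^sub>M lborel) borel (\<lambda>(x, y). Complex x y)) (box l u)
     = emeasure (lborel \<Otimes>\<^sub>M lborel) ({Re l<..<Re u} \<times> {Im l<..<Im u})"
    by (subst emeasure_distr) auto
  also have "\<dots> = ennreal (Re u - Re l) * ennreal (Im u - Im l)"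
    using le' by (subst lborel.emeasure_pair_measure_Times) auto
  also have "\<dots> = ennreal (\<Prod>b\<in>Basis. (u - l) \<bullet> b)"
    using le' by (simp add: Basis_complex_def inner_complex_def ennreal_mult)
  finally show "emeasure (distr (lborel \<Otimes>\<^sub>M lborel) borel (\<lambda>(x, y). Complex x y)) (box l u)
     = ennreal (\<Prod>b\<in>Basis. (u - l) \<bullet> b)" .
qed

lemma borel_measurable_Complex[measurable (raw)]:
  assumes [measurable]: "f \<in> borel_measurable M" "g \<in> borel_measurable M"
  shows "(\<lambda>x. Complex (f x) (g x)) \<in> borel_measurable M"
  unfolding Complex_eq by measurable

lemma nn_integral_complex_iterated:
  fixes F :: "complex \<Rightarrow> ennreal"
  assumes [measurable]: "F \<in> borel_measurable borel"
  shows "(\<integral>\<^sup>+z. F z \<partial>lborel) = (\<integral>\<^sup>+x. \<integral>\<^sup>+y. F (Complex x y) \<partial>lborel \<partial>lborel)"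
  by (subst lborel_complex_eq, subst nn_integral_distr)
     (auto simp: lborel.nn_integral_fst[symmetric] case_prod_unfold)

lemma nn_integral_complex_iterated':
  fixes F :: "complex \<Rightarrow> ennreal"
  assumes [measurable]: "F \<in> borel_measurable borel"
  shows "(\<integral>\<^sup>+z. F z \<partial>lborel) = (\<integral>\<^sup>+y. \<integral>\<^sup>+x. F (Complex x y) \<partial>lborel \<partial>lborel)"
  unfolding nn_integral_complex_iterated[OF assms] by (rule lborel_pair.Fubini') measurable

text \<open>With nonzero real part, a rotation is an affine change of x followed by an affine change
  of y, whose Jacobian factors cancel. The excluded unimodular numbers are only i and -i.\<close>

lemma nn_integral_lborel_rotate:
  fixes F :: "complex \<Rightarrow> ennreal" and w :: complex
  assumes F[measurable]: "F \<in> borel_measurable borel" and w: "cmod w = 1" "Re w \<noteq> 0"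
  shows "(\<integral>\<^sup>+z. F (w * z) \<partial>lborel) = (\<integral>\<^sup>+z. F z \<partial>lborel)"
proof -
  define a b where "a = Re w" and "b = Im w"
  have a: "a \<noteq> 0" and ab: "a\<^sup>2 + b\<^sup>2 = 1" using w by (auto simp: a_def b_def cmod_def)
  \<comment> \<open>For fixed y the new abscissa is a x - b y. Expressed through it, the ordinate b
    x + a y has slope 1 / a in y, by \<open>ab\<close>.\<close>
  have eq: "w * Complex x y = Complex (- (b * y) + a * x) (b / a * (- (b * y) + a * x) + (1 / a) * y)" for x y
  proof -
    have "b * x + a * y = b / a * (- (b * y) + a * x) + (1 / a) * y"
    proof -
      have "a * (a * y) + b * (b * y) = (a\<^sup>2 + b\<^sup>2) * y" by (simp add: algebra_simps power2_eq_square)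
      then have "a * (a * y) + b * (b * y) = y" unfolding ab by simp
      then show ?thesis using a by (simp add: field_simps)
    qed
    then show ?thesis by (simp add: complex_eq_iff a_def b_def)
  qed
  have "ennreal \<bar>a\<bar> * (\<integral>\<^sup>+z. F (w * z) \<partial>lborel)
     = (\<integral>\<^sup>+y. ennreal \<bar>a\<bar> * (\<integral>\<^sup>+x. F (w * Complex x y) \<partial>lborel) \<partial>lborel)"
    by (subst nn_integral_complex_iterated', measurable, subst nn_integral_cmult) auto
  also have "\<dots> = (\<integral>\<^sup>+y. \<integral>\<^sup>+x. F (Complex x (b / a * x + (1 / a) * y)) \<partial>lborel \<partial>lborel)"
  proof (rule nn_integral_cong)
    fix y :: real
    show "ennreal \<bar>a\<bar> * (\<integral>\<^sup>+x. F (w * Complex x y) \<partial>lborel) = (\<integral>\<^sup>+x. F (Complex x (b / a * x + (1 / a) * y)) \<partial>lborel)"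
      unfolding eq
      by (rule nn_integral_real_affine[symmetric, where f = "\<lambda>x. F (Complex x (b / a * x + (1 / a) * y))"]) (use a in auto)
  qed
  also have "\<dots> = (\<integral>\<^sup>+x. \<integral>\<^sup>+y. F (Complex x (b / a * x + (1 / a) * y)) \<partial>lborel \<partial>lborel)"
    by (rule lborel_pair.Fubini') measurable
  also have "\<dots> = (\<integral>\<^sup>+x. ennreal \<bar>a\<bar> * (\<integral>\<^sup>+y. F (Complex x y) \<partial>lborel) \<partial>lborel)"
  proof (rule nn_integral_cong)
    fix x :: real
    have "(\<integral>\<^sup>+y. F (Complex x y) \<partial>lborel) = ennreal \<bar>1 / a\<bar> * (\<integral>\<^sup>+y. F (Complex x (b / a * x + (1 / a) * y)) \<partial>lborel)"
      by (rule nn_integral_real_affine) (use a in auto)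
    then show "(\<integral>\<^sup>+y. F (Complex x (b / a * x + (1 / a) * y)) \<partial>lborel) = ennreal \<bar>a\<bar> * (\<integral>\<^sup>+y. F (Complex x y) \<partial>lborel)"
      using a by (simp add: mult.assoc[symmetric] ennreal_mult[symmetric])
  qed
  also have "\<dots> = ennreal \<bar>a\<bar> * (\<integral>\<^sup>+z. F z \<partial>lborel)"
    by (subst nn_integral_complex_iterated, measurable, subst nn_integral_cmult) auto
  finally show ?thesis using a by (simp add: ennreal_mult_cancel_left)
qed

text \<open>The shifted window from a to T + a is cut at T, and its right piece is moved back by one
  period.\<close>

lemma nn_integral_periodic_shift:
  fixes f :: "real \<Rightarrow> ennreal"
  assumes [measurable]: "f \<in> borel_measurable borel" and per: "\<And>x. f (x + T) = f x"
    and a: "0 \<le> a" "a \<le> T"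
  shows "(\<integral>\<^sup>+x\<in>{0..<T}. f (x + a) \<partial>lborel) = (\<integral>\<^sup>+x\<in>{0..<T}. f x \<partial>lborel)"
proof -
  have shift: "(\<integral>\<^sup>+x. g (x + d) \<partial>lborel) = (\<integral>\<^sup>+x. g x \<partial>lborel)"
    if [measurable]: "g \<in> borel_measurable borel" for g :: "real \<Rightarrow> ennreal" and d
    using nn_integral_real_affine[of g 1 d] by (simp add: add.commute)
  have "(\<integral>\<^sup>+x\<in>{0..<T}. f (x + a) \<partial>lborel) = (\<integral>\<^sup>+x. f (x + a) * indicator {a..<T + a} (x + a) \<partial>lborel)"
    by (intro nn_integral_cong) (auto simp: indicator_def)
  also have "\<dots> = (\<integral>\<^sup>+x. f x * indicator {a..<T + a} x \<partial>lborel)"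
    by (rule shift) measurable
  also have "\<dots> = (\<integral>\<^sup>+x. f x * indicator {a..<T} x + f x * indicator {T..<T + a} x \<partial>lborel)"
    using a by (intro nn_integral_cong) (auto simp: indicator_def)
  also have "\<dots> = (\<integral>\<^sup>+x. f x * indicator {a..<T} x \<partial>lborel) + (\<integral>\<^sup>+x. f x * indicator {T..<T + a} x \<partial>lborel)"
    by (rule nn_integral_add) auto
  also have "(\<integral>\<^sup>+x. f x * indicator {T..<T + a} x \<partial>lborel) = (\<integral>\<^sup>+x. f (x + T) * indicator {T..<T + a} (x + T) \<partial>lborel)"
    by (rule shift[symmetric]) measurable
  also have "\<dots> = (\<integral>\<^sup>+x. f x * indicator {0..<a} x \<partial>lborel)"
    by (intro nn_integral_cong) (auto simp: indicator_def per)
  also have "(\<integral>\<^sup>+x. f x * indicator {a..<T} x \<partial>lborel) + \<dots> = (\<integral>\<^sup>+x. f x * indicator {a..<T} x + f x * indicator {0..<a} x \<partial>lborel)"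
    by (rule nn_integral_add[symmetric]) auto
  also have "\<dots> = (\<integral>\<^sup>+x\<in>{0..<T}. f x \<partial>lborel)"
    using a by (intro nn_integral_cong) (auto simp: indicator_def)
  finally show ?thesis .
qed

text \<open>This is the law of the modulus. Its tails are areas of annuli, pi - pi x^2 for x between
  0 and 1, and tails determine a finite measure.\<close>

lemma distr_cmod_unit_disc:
  "distr (density lborel (indicator (ball 0 1))) borel cmod
     = density lborel (\<lambda>r. ennreal (2 * pi * r) * indicator {0<..<1} r)" (is "?M = ?N")
proof (rule measure_eqI_lessThan)
  have M: "emeasure ?M {x<..} = emeasure lborel (ball 0 1 \<inter> cmod -` {x<..})" for x
  proof -
    have [measurable]: "cmod -` {x<..} \<in> sets borel"
      using measurable_sets[of cmod borel borel "{x<..}"] by simp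
    have "emeasure ?M {x<..} = emeasure (density lborel (indicator (ball 0 1))) (cmod -` {x<..})"
      by (subst emeasure_distr) auto
    also have "\<dots> = (\<integral>\<^sup>+z. indicator (ball 0 1 \<inter> cmod -` {x<..}) z \<partial>lborel)"
      by (subst emeasure_density[OF borel_measurable_indicator]) (simp, simp, intro nn_integral_cong, simp only: indicator_inter_arith)
    finally show ?thesis by simp
  qed
  have le: "emeasure ?M {x<..} \<le> emeasure lborel (ball (0::complex) 1)" for x
    unfolding M by (rule emeasure_mono) auto
  then show "emeasure ?M {x<..} < \<infinity>" for x
    by (rule le_less_trans) (simp add: emeasure_ball)
  have FTC: "(\<integral>\<^sup>+r. ennreal (2 * pi * r) * indicator {a..1} r \<partial>lborel) = ennreal (pi - pi * a\<^sup>2)"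
    if "0 \<le> a" "a \<le> 1" for a :: real
    using that by (subst nn_integral_FTC_Icc[where F = "\<lambda>r. pi * r\<^sup>2"])
      (auto intro!: derivative_eq_intros)
  have N: "emeasure ?N {x<..} = (\<integral>\<^sup>+r. ennreal (2 * pi * r) * indicator {max 0 x..1} r \<partial>lborel)" for x
    by (subst emeasure_density, simp, simp, rule nn_integral_cong_AE,
        rule eventually_mono[OF AE_conjI[OF AE_lborel_singleton[of "max 0 x"] AE_lborel_singleton[of 1]]])
       (auto simp: indicator_def)
  show "emeasure ?M {x<..} = emeasure ?N {x<..}" for x
  proof -
    consider "x < 0" | "0 \<le> x" "x < 1" | "1 \<le> x" by linarith
    then show ?thesis
    proof cases
      case 1
      then have "cmod -` {x<..} = UNIV" using less_le_trans[OF 1 norm_ge_zero] by auto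
      then show ?thesis using 1 FTC[of 0] by (simp add: M N emeasure_ball unit_ball_vol_2)
    next
      case 2
      have "ball 0 1 \<inter> cmod -` {x<..} = ball 0 1 - cball 0 x" by (auto simp: dist_norm)
      then have "emeasure ?M {x<..} = emeasure lborel (ball (0::complex) 1) - emeasure lborel (cball (0::complex) x)"
        unfolding M using 2 by (simp add: emeasure_Diff emeasure_cball cball_subset_ball_iff)
      also have "\<dots> = ennreal (pi - pi * x\<^sup>2)"
        using 2 by (simp add: emeasure_ball emeasure_cball unit_ball_vol_2 ennreal_minus)
      finally show ?thesis using 2 FTC[of x] by (simp add: N)
    next
      case 3
      then have "ball 0 1 \<inter> cmod -` {x<..} = {}" by auto
      moreover have "(\<integral>\<^sup>+r. ennreal (2 * pi * r) * indicator {max 0 x..1} r \<partial>lborel) = (\<integral>\<^sup>+r. 0 \<partial>(lborel :: real measure))"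
        using 3 by (intro nn_integral_cong_AE eventually_mono[OF AE_lborel_singleton[of 1]]) (auto simp: indicator_def)
      ultimately show ?thesis by (simp add: M N)
    qed
  qed
qed auto

text \<open>Averaging the disc integral over all rotations leaves it unchanged. Once the integrals
  are exchanged, the angular integral depends on the modulus alone, and the law of the modulus
  finishes.\<close>

lemma nn_integral_unit_disc_polar:
  fixes F :: "complex \<Rightarrow> ennreal"
  assumes [measurable]: "F \<in> borel_measurable borel"
  shows "(\<integral>\<^sup>+z\<in>ball 0 1. F z \<partial>lborel)
    = (\<integral>\<^sup>+r\<in>{0<..<1}. ennreal r * (\<integral>\<^sup>+\<theta>\<in>{0..2*pi}. F (rcis r \<theta>) \<partial>lborel) \<partial>lborel)"
proof -
  have [measurable]: "(\<lambda>(r, \<theta>). rcis r \<theta>) \<in> borel_measurable (borel \<Otimes>\<^sub>M borel)"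
    by (simp add: borel_prod[symmetric] case_prod_unfold rcis_def cis_conv_exp)
  have [measurable]: "ball 0 1 \<in> sets (borel :: complex measure)" by simp
  have Fm: "(\<lambda>z. F z * indicator (ball 0 1) z) \<in> borel_measurable borel"
    by (intro borel_measurable_times_ennreal assms borel_measurable_indicator) simp
  have [measurable]: "cis \<in> borel_measurable borel"
    by (intro borel_measurable_continuous_onI continuous_intros)
  have Icc: "(\<integral>\<^sup>+\<theta>\<in>{0..2*pi}. g \<theta> \<partial>lborel) = (\<integral>\<^sup>+\<theta>\<in>{0..<2*pi}. g \<theta> \<partial>lborel)" for g :: "real \<Rightarrow> ennreal"
    by (intro nn_integral_cong_AE eventually_mono[OF AE_lborel_singleton[of "2*pi"]]) (auto simp: indicator_def)
  define \<Phi> where "\<Phi> r = (\<integral>\<^sup>+\<theta>\<in>{0..<2*pi}. F (rcis r \<theta>) \<partial>lborel)" for r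
  have [measurable]: "\<Phi> \<in> borel_measurable borel" unfolding \<Phi>_def by measurable
  let ?I = "\<integral>\<^sup>+z\<in>ball 0 1. F z \<partial>lborel"
  have "ennreal (2 * pi) * ?I = (\<integral>\<^sup>+\<theta>\<in>{0..<2*pi}. ?I \<partial>(lborel :: real measure))"
    by (subst nn_integral_cmult_indicator) (auto simp: mult.commute)
  also have "\<dots> = (\<integral>\<^sup>+\<theta>\<in>{0..<2*pi}. (\<integral>\<^sup>+z\<in>ball 0 1. F (cis \<theta> * z) \<partial>lborel) \<partial>lborel)"
  proof (rule nn_integral_cong_AE, rule eventually_mono[OF AE_conjI])
    \<comment> \<open>At these two angles \<open>cis \<theta>\<close> is purely imaginary, the case
      left out of the rotation lemma.\<close>
    show "AE \<theta> in lborel. \<theta> \<noteq> pi / 2" "AE \<theta> in lborel. \<theta> \<noteq> 3 * pi / 2"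
      by (rule AE_lborel_singleton)+
    fix \<theta> :: real assume \<theta>: "\<theta> \<noteq> pi / 2 \<and> \<theta> \<noteq> 3 * pi / 2"
    show "?I * indicator {0..<2*pi} \<theta> = (\<integral>\<^sup>+z\<in>ball 0 1. F (cis \<theta> * z) \<partial>lborel) * indicator {0..<2*pi} \<theta>"
    proof (cases "\<theta> \<in> {0..<2*pi}")
      case True
      have "cos \<theta> \<noteq> 0"
      proof
        assume "cos \<theta> = 0"
        then obtain i where i: "odd i" "\<theta> = of_int i * (pi / 2)" by (auto simp: cos_zero_iff_int)
        with True have "0 \<le> real_of_int i" "real_of_int i < 4" using pi_gt_zero by (auto simp: field_simps zero_le_mult_iff dest: less_le_not_le[THEN iffD1])
        then have "i \<in> {0, 1, 2, 3}" by auto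
        with i \<theta> show False by auto
      qed
      then have "(\<integral>\<^sup>+z. F (cis \<theta> * z) * indicator (ball 0 1) (cis \<theta> * z) \<partial>lborel) = ?I"
        using nn_integral_lborel_rotate[OF Fm, of "cis \<theta>"] by simp
      moreover have "indicator (ball 0 1) (cis \<theta> * z) = (indicator (ball 0 1) z :: ennreal)" for z
        by (simp add: indicator_def norm_mult)
      ultimately show ?thesis by simp
    qed simp
  qed
  also have "\<dots> = (\<integral>\<^sup>+\<theta>. (\<integral>\<^sup>+z. F (cis \<theta> * z) * indicator (ball 0 1) z * indicator {0..<2*pi} \<theta> \<partial>lborel) \<partial>lborel)"
    by (intro nn_integral_cong nn_integral_multc[symmetric]) measurable
  also have "\<dots> = (\<integral>\<^sup>+z. (\<integral>\<^sup>+\<theta>. F (cis \<theta> * z) * indicator (ball 0 1) z * indicator {0..<2*pi} \<theta> \<partial>lborel) \<partial>lborel)"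
    by (rule pair_sigma_finite.Fubini') (auto intro!: pair_sigma_finite.intro sigma_finite_lborel)
  also have "\<dots> = (\<integral>\<^sup>+z\<in>ball 0 1. \<Phi> (cmod z) \<partial>lborel)"
  proof (rule nn_integral_cong)
    fix z :: complex
    \<comment> \<open>The argument of z acts as a shift of the angle, which an integral over a full
      period does not see.\<close>
    define a where "a = Arg2pi z"
    have z: "z = rcis (cmod z) a" using Arg2pi_eq[of z] by (simp add: a_def rcis_def cis_conv_exp)
    have "cis \<theta> * z = rcis (cmod z) (\<theta> + a)" for \<theta>
      using z unfolding rcis_def by (metis cis_mult mult.left_commute)
    then have eq: "(\<integral>\<^sup>+\<theta>\<in>{0..<2*pi}. F (cis \<theta> * z) \<partial>lborel) = (\<integral>\<^sup>+\<theta>\<in>{0..<2*pi}. F (rcis (cmod z) (\<theta> + a)) \<partial>lborel)"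
      by simp
    have "cis (x + 2 * pi) = cis x" for x by (simp add: complex_eq_iff)
    then have "rcis (cmod z) (x + 2 * pi) = rcis (cmod z) x" for x by (simp add: rcis_def)
    then have "(\<integral>\<^sup>+\<theta>\<in>{0..<2*pi}. F (rcis (cmod z) (\<theta> + a)) \<partial>lborel) = \<Phi> (cmod z)"
      unfolding \<Phi>_def
      by (intro nn_integral_periodic_shift[where f = "\<lambda>\<theta>. F (rcis (cmod z) \<theta>)"])
         (auto simp: a_def Arg2pi_ge_0 Arg2pi_lt_2pi less_imp_le)
    with eq have "(\<integral>\<^sup>+\<theta>\<in>{0..<2*pi}. F (cis \<theta> * z) \<partial>lborel) = \<Phi> (cmod z)" by simp
    then show "(\<integral>\<^sup>+\<theta>. F (cis \<theta> * z) * indicator (ball 0 1) z * indicator {0..<2*pi} \<theta> \<partial>lborel)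
      = \<Phi> (cmod z) * indicator (ball 0 1) z"
      by (cases "z \<in> ball 0 1") simp_all
  qed
  also have "\<dots> = (\<integral>\<^sup>+r. \<Phi> r \<partial>distr (density lborel (indicator (ball 0 1))) borel cmod)"
    by (simp add: nn_integral_distr nn_integral_density mult.commute)
  also have "\<dots> = (\<integral>\<^sup>+r. ennreal (2 * pi) * (ennreal r * \<Phi> r * indicator {0<..<1} r) \<partial>lborel)"
    unfolding distr_cmod_unit_disc
    by (subst nn_integral_density)
       (auto intro!: nn_integral_cong simp: indicator_def ennreal_mult mult_ac)
  also have "\<dots> = ennreal (2 * pi) * (\<integral>\<^sup>+r\<in>{0<..<1}. ennreal r * \<Phi> r \<partial>lborel)"
    by (rule nn_integral_cmult) measurable
  finally have "?I = (\<integral>\<^sup>+r\<in>{0<..<1}. ennreal r * \<Phi> r \<partial>lborel)"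
    by (simp add: ennreal_mult_cancel_left)
  then show ?thesis unfolding \<Phi>_def Icc .
qed

section \<open>The Fejer--Riesz inequality\<close>

text \<open>On [0, pi/2] the concave sine lies above its chord, whose slope 2 / pi is at least 1 /
  2; reflection at pi/2 gives the rest.\<close>

lemma sin_ge_half:
  fixes x :: real
  assumes "0 \<le> x" "x \<le> pi"
  shows "min x (pi - x) / 2 \<le> sin x"
proof -
  have conc: "concave_on {0..pi / 2} sin"
    by (rule f''_le0_imp_concave[where f' = cos and f'' = "\<lambda>x. - sin x"])
       (auto intro!: derivative_eq_intros sin_ge_zero)
  have *: "y / 2 \<le> sin y" if "0 \<le> y" "y \<le> pi / 2" for y
  proof -
    have "y / (pi / 2) \<le> sin y"
      using concave_onD_Icc'[OF conc, of y] that by (simp add: mult.commute)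
    moreover have "y / 2 \<le> y / (pi / 2)"
      using that pi_less_4 mult_right_mono[of pi 4 y] by (simp add: field_simps)
    ultimately show ?thesis by linarith
  qed
  show ?thesis
    using *[of x] *[of "pi - x"] assms by (cases "x \<le> pi / 2") auto
qed

text \<open>The 6 is 1 + 1 + 4. Both 1 - t and 1 - r are at most 1 - t r, hence at most the modulus
  on the right. The angular distance is at most twice |1 - \<open>cis \<theta>\<close>|, and the
  triangle inequality through \<open>w\<close> costs another factor 2.\<close>

lemma hilbert_kernel_lower_bound:
  fixes t r \<theta> :: real
  assumes "0 \<le> t" "t \<le> 1" "0 \<le> r" "r \<le> 1" "0 \<le> \<theta>" "\<theta> \<le> 2 * pi"
  shows "(1 - t) + (1 - r) + min \<theta> (2 * pi - \<theta>) \<le> 6 * cmod (1 - of_real t * rcis r \<theta>)"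
proof -
  define w where "w = of_real t * rcis r \<theta>"
  have tr: "t * r \<le> t" "t * r \<le> r" "t * r \<le> 1" "0 \<le> t * r"
    using assms by (auto simp: mult_left_le mult_left_le_one_le mult_le_one)
  have w: "w = of_real (t * r) * cis \<theta>" by (simp add: w_def rcis_def)
  then have "cmod w = t * r" using tr by (simp add: norm_mult)
  then have 1: "1 - t * r \<le> cmod (1 - w)"
    using norm_triangle_ineq2[of 1 w] by simp
  have "cmod (w - cis \<theta>) = cmod (of_real (t * r - 1) * cis \<theta>)"
    unfolding w by (simp add: algebra_simps)
  then have 2: "cmod (w - cis \<theta>) = 1 - t * r"
    using tr by (simp only: norm_mult norm_of_real norm_cis) simp
  have "(cmod (1 - cis \<theta>))\<^sup>2 = 2 - 2 * cos \<theta>"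
    by (simp add: cmod_power2 power2_diff)
  also have "\<dots> = (2 * sin (\<theta> / 2))\<^sup>2"
    using cos_double_sin[of "\<theta> / 2"] by (simp add: power_mult_distrib)
  finally have sq: "(cmod (1 - cis \<theta>))\<^sup>2 = (2 * sin (\<theta> / 2))\<^sup>2" .
  have "0 \<le> sin (\<theta> / 2)" using sin_ge_zero[of "\<theta> / 2"] assms by simp
  then have "cmod (1 - cis \<theta>) = 2 * sin (\<theta> / 2)"
    by (intro power2_eq_imp_eq[OF sq]) simp_all
  then have 3: "min \<theta> (2 * pi - \<theta>) \<le> 2 * cmod (1 - cis \<theta>)"
    using sin_ge_half[of "\<theta> / 2"] assms by (auto simp: min_def split: if_splits)
  have "cmod (1 - cis \<theta>) \<le> cmod (1 - w) + cmod (w - cis \<theta>)"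
    using norm_triangle_ineq[of "1 - w" "w - cis \<theta>"] by simp
  with 1 2 3 tr show ?thesis by (simp flip: w_def)
qed

lemma powr_add_le:
  fixes a b p :: real
  assumes "0 \<le> a" "0 \<le> b" "0 \<le> p"
  shows "(a + b) powr p \<le> 2 powr p * (a powr p + b powr p)"
proof -
  have "(a + b) powr p \<le> (2 * max a b) powr p" using assms by (intro powr_mono2) auto
  also have "\<dots> = 2 powr p * max a b powr p" using assms by (simp add: powr_mult)
  also have "max a b powr p \<le> a powr p + b powr p" by (simp add: max_def)
  finally show ?thesis by (simp add: mult_left_mono)
qed

lemma nn_integral_reflect:
  fixes f :: "real \<Rightarrow> ennreal"
  assumes [measurable]: "f \<in> borel_measurable borel"
  shows "(\<integral>\<^sup>+x. f (a - x) \<partial>lborel) = (\<integral>\<^sup>+x. f x \<partial>lborel)"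
  using nn_integral_real_affine[of f "-1" a] by simp

lemma circle_in_unit_disc: "0 \<le> r \<Longrightarrow> r < 1 \<Longrightarrow> rcis r \<theta> \<in> ball 0 1"
  by simp

lemma continuous_on_circle:
  assumes "f holomorphic_on ball 0 1" "0 \<le> r" "r < 1"
  shows "continuous_on UNIV (\<lambda>\<theta>. f (rcis r \<theta>))"
proof -
  have "continuous_on UNIV (\<lambda>\<theta>. rcis r \<theta>)" unfolding rcis_def by (intro continuous_intros)
  then show ?thesis
    using continuous_on_compose2[OF holomorphic_on_imp_continuous_on[OF assms(1)]] assms
    by (metis circle_in_unit_disc image_subset_iff)
qed

lemma circle_norm_measurable:
  assumes "f holomorphic_on ball 0 1" "0 \<le> r" "r < 1"
  shows "(\<lambda>\<theta>. cmod (f (rcis r \<theta>))) \<in> borel_measurable borel"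
  using continuous_on_circle[OF assms] by (intro borel_measurable_continuous_onI continuous_intros)

text \<open>The evaluation point R t scales with the circle, so the factor R of the Cauchy
  denominator cancels the one in the line element. Staying on a circle inside the disc avoids
  boundary values of f.\<close>

lemma Cauchy_radius_bound:
  assumes f: "f holomorphic_on ball 0 1" and R: "0 < R" "R < 1" and t: "0 \<le> t" "t < 1"
  shows "ennreal (2 * pi * cmod (f (of_real (R * t))))
    \<le> (\<integral>\<^sup>+\<theta>\<in>{0..2*pi}. ennreal (cmod (f (rcis R \<theta>)) / cmod (1 - of_real t * cis \<theta>)) \<partial>lborel)"
proof -
  let ?w = "complex_of_real (R * t)"
  let ?F = "\<lambda>\<theta>. f (rcis R \<theta>) / (rcis R \<theta> - ?w) * R * \<i> * cis \<theta>"
  have "cball 0 R \<subseteq> ball (0::complex) 1" using R by auto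
  then have "((\<lambda>u. f u / (u - ?w)) has_contour_integral (2 * of_real pi * \<i> * f ?w)) (circlepath 0 R)"
    using R t by (intro Cauchy_integral_circlepath_simple holomorphic_on_subset[OF f])
      (auto simp: norm_mult mult_less_cancel_left1)
  then have hi: "(?F has_integral (2 * of_real pi * \<i> * f ?w)) {0..2*pi}"
    unfolding circlepath_def by (subst (asm) has_contour_integral_part_circlepath_iff) (auto simp: rcis_def)
  have ne: "rcis R \<theta> \<noteq> ?w" for \<theta>
  proof
    assume "rcis R \<theta> = ?w"
    then have "cmod (rcis R \<theta>) = cmod ?w" by simp
    then show False using R t by (simp add: norm_mult)
  qed
  have "continuous_on {0..2*pi} (\<lambda>\<theta>. f (rcis R \<theta>))"
    using continuous_on_circle[OF f, of R] R by (auto intro: continuous_on_subset)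
  then have "continuous_on {0..2*pi} ?F"
    by (intro continuous_intros) (use ne in \<open>auto simp: rcis_def intro!: continuous_intros\<close>)
  then have si: "set_integrable lborel {0..2*pi} ?F" by (rule borel_integrable_atLeastAtMost')
  have "2 * pi * cmod (f ?w) = cmod (2 * of_real pi * \<i> * f ?w)" by (simp add: norm_mult)
  also have "2 * of_real pi * \<i> * f ?w = (LINT \<theta>:{0..2*pi}|lborel. ?F \<theta>)"
    using set_borel_integral_eq_integral(2)[OF si] hi by (simp add: integral_unique)
  finally have "ennreal (2 * pi * cmod (f ?w)) = ennreal (cmod (LINT \<theta>:{0..2*pi}|lborel. ?F \<theta>))" by simp
  also have "\<dots> \<le> (\<integral>\<^sup>+\<theta>. ennreal (cmod (indicator {0..2*pi} \<theta> *\<^sub>R ?F \<theta>)) \<partial>lborel)"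
    unfolding set_lebesgue_integral_def
    by (rule integral_norm_bound_ennreal) (use si in \<open>simp add: set_integrable_def\<close>)
  also have "\<dots> = (\<integral>\<^sup>+\<theta>\<in>{0..2*pi}. ennreal (cmod (f (rcis R \<theta>)) / cmod (1 - of_real t * cis \<theta>)) \<partial>lborel)"
  proof (intro nn_integral_cong)
    fix \<theta>
    have "rcis R \<theta> - ?w = of_real R * (cis \<theta> - of_real t)" by (simp add: rcis_def algebra_simps)
    then have "cmod (rcis R \<theta> - ?w) = R * cmod (cis \<theta> - of_real t)" using R by (simp add: norm_mult)
    \<comment> \<open>On the unit circle the two differences agree up to conjugation and a
      unimodular factor.\<close>
    also have "cis \<theta> - of_real t = cis \<theta> * cnj (1 - of_real t * cis \<theta>)"
      by (simp add: algebra_simps complex_norm_square[symmetric] mult.left_commute[of "cis \<theta>"] cis_cnj cis_mult)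
    also have "cmod \<dots> = cmod (1 - of_real t * cis \<theta>)" by (simp only: norm_mult norm_cis complex_mod_cnj mult_1)
    finally show "ennreal (cmod (indicator {0..2*pi} \<theta> *\<^sub>R ?F \<theta>))
      = ennreal (cmod (f (rcis R \<theta>)) / cmod (1 - of_real t * cis \<theta>)) * indicator {0..2*pi} \<theta>"
      using R by (simp add: norm_mult norm_divide indicator_def)
  qed
  finally show ?thesis .
qed

text \<open>The weighted inequality is used with c = 1 and g = 0, the angle being the inner variable
  and the distance to the circle the outer one. The factor \<open>R\<close> in the bound is
  essential later: it becomes the r of the area element in the Bergman case.\<close>

lemma fejer_riesz:
  fixes p :: real
  assumes p: "p > 1"
  shows "\<exists>C>0. \<forall>f R. f holomorphic_on ball 0 1 \<longrightarrow> 0 < R \<longrightarrow> R < 1 \<longrightarrow>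
    (\<integral>\<^sup>+u\<in>{0<..<R}. ennreal (cmod (f (of_real u)) powr p) \<partial>lborel)
      \<le> ennreal (C * R) * (\<integral>\<^sup>+\<theta>\<in>{0..2*pi}. ennreal (cmod (f (rcis R \<theta>)) powr p) \<partial>lborel)"
proof -
  obtain C where C: "C > 0" and hilb: "\<And>h A. h \<in> borel_measurable borel \<Longrightarrow> (\<And>s. 0 \<le> h s) \<Longrightarrow> (\<And>v. v > 0 \<Longrightarrow> 0 \<le> A v) \<Longrightarrow>
    (\<And>v. v > 0 \<Longrightarrow> ennreal (A v) \<le> (\<integral>\<^sup>+s\<in>{0<..}. ennreal (h s * (s + v) powr - 1) \<partial>lborel)) \<Longrightarrow>
    (\<integral>\<^sup>+v\<in>{0<..}. ennreal (A v powr p * v powr 0) \<partial>lborel)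
      \<le> ennreal C * (\<integral>\<^sup>+s\<in>{0<..}. ennreal (h s powr p * s powr (0 + p * (1 - 1))) \<partial>lborel)"
    using weighted_hilbert_inequality[of p 0 1] p by auto
  \<comment> \<open>The cost of folding the circle: \<open>2 powr p\<close> for a sum of two values
    of \<open>F\<close>, and 2 because each of them contributes the full circle integral.\<close>
  define D where "D = C * (2 powr p * 2)"
  show ?thesis
  proof (intro exI[of _ D] conjI allI impI)
    show D0: "D > 0" using C by (simp add: D_def)
    fix f :: "complex \<Rightarrow> complex" and R :: real
    assume f: "f holomorphic_on ball 0 1" and R: "0 < R" "R < 1"
    define F where "F \<theta> = cmod (f (rcis R \<theta>))" for \<theta>
    have [measurable]: "F \<in> borel_measurable borel"
      using circle_norm_measurable[OF f, of R] R unfolding F_def by simp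
    have F0: "0 \<le> F \<theta>" for \<theta> by (simp add: F_def)
    \<comment> \<open>The point 1 is approached at both ends of [0, 2 pi]; after folding, small
      arguments represent both.\<close>
    define h where "h \<theta> = indicator {0..2*pi} \<theta> * (F \<theta> + F (2*pi - \<theta>))" for \<theta> :: real
    have [measurable]: "h \<in> borel_measurable borel" unfolding h_def by measurable
    \<comment> \<open>Here \<open>v\<close> is the relative distance 1 - u / R of the point u = R (1
      - v) to the circle; past the centre the function is cut off.\<close>
    define A where "A v = (if v < 1 then cmod (f (of_real (R * (1 - v)))) else 0)" for v
    let ?M = "\<integral>\<^sup>+\<theta>\<in>{0..2*pi}. ennreal (F \<theta> powr p) \<partial>lborel"
    have AA: "ennreal (A v) \<le> (\<integral>\<^sup>+s\<in>{0<..}. ennreal (h s * (s + v) powr - 1) \<partial>lborel)" if v: "v > 0" for v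
    proof (cases "v < 1")
      case True
      have "ennreal (2 * pi * A v) \<le> (\<integral>\<^sup>+\<theta>\<in>{0..2*pi}. ennreal (F \<theta> / cmod (1 - of_real (1 - v) * cis \<theta>)) \<partial>lborel)"
        using Cauchy_radius_bound[OF f R, of "1 - v"] True v by (simp add: A_def F_def)
      also have "\<dots> \<le> (\<integral>\<^sup>+\<theta>. ennreal (indicator {0..2*pi} \<theta> * 6 * F \<theta> * (\<theta> + v) powr - 1) +
            ennreal (indicator {0..2*pi} \<theta> * 6 * F \<theta> * (2 * pi - \<theta> + v) powr - 1) \<partial>lborel)"
      proof (intro nn_integral_mono)
        fix \<theta> :: real
        show "ennreal (F \<theta> / cmod (1 - of_real (1 - v) * cis \<theta>)) * indicator {0..2*pi} \<theta>
          \<le> ennreal (indicator {0..2*pi} \<theta> * 6 * F \<theta> * (\<theta> + v) powr - 1) +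
            ennreal (indicator {0..2*pi} \<theta> * 6 * F \<theta> * (2 * pi - \<theta> + v) powr - 1)"
        proof (cases "\<theta> \<in> {0..2*pi}")
          case True
          define m where "m = min \<theta> (2 * pi - \<theta>)"
          have m0: "m \<ge> 0" using True by (simp add: m_def)
          have "v + m \<le> 6 * cmod (1 - of_real (1 - v) * cis \<theta>)"
            using hilbert_kernel_lower_bound[of "1 - v" 1 \<theta>] True v \<open>v < 1\<close> by (simp add: m_def rcis_def)
          then have "1 / cmod (1 - of_real (1 - v) * cis \<theta>) \<le> 6 / (m + v)"
            using v m0 by (simp add: divide_simps split: if_splits)
          also have "\<dots> \<le> 6 * ((\<theta> + v) powr - 1 + (2 * pi - \<theta> + v) powr - 1)"
            using v True by (simp add: m_def min_def powr_minus divide_inverse)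
          finally have "F \<theta> * (1 / cmod (1 - of_real (1 - v) * cis \<theta>))
            \<le> F \<theta> * (6 * ((\<theta> + v) powr - 1 + (2 * pi - \<theta> + v) powr - 1))"
            by (intro mult_left_mono F0)
          then show ?thesis
            using True F0 by (simp add: ennreal_plus[symmetric] algebra_simps ennreal_leI del: ennreal_plus)
        qed simp
      qed
      also have "\<dots> = (\<integral>\<^sup>+\<theta>. ennreal (indicator {0..2*pi} \<theta> * 6 * F \<theta> * (\<theta> + v) powr - 1) \<partial>lborel) +
         (\<integral>\<^sup>+\<theta>. ennreal (indicator {0..2*pi} \<theta> * 6 * F \<theta> * (2 * pi - \<theta> + v) powr - 1) \<partial>lborel)"
        by (rule nn_integral_add) auto
      also have "(\<integral>\<^sup>+\<theta>. ennreal (indicator {0..2*pi} \<theta> * 6 * F \<theta> * (2 * pi - \<theta> + v) powr - 1) \<partial>lborel)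
        = (\<integral>\<^sup>+\<theta>. ennreal (indicator {0..2*pi} (2*pi - \<theta>) * 6 * F (2*pi - \<theta>) * (2 * pi - (2*pi - \<theta>) + v) powr - 1) \<partial>lborel)"
        by (rule nn_integral_reflect[symmetric]) measurable
      also have "(\<integral>\<^sup>+\<theta>. ennreal (indicator {0..2*pi} \<theta> * 6 * F \<theta> * (\<theta> + v) powr - 1) \<partial>lborel) + \<dots>
        = (\<integral>\<^sup>+\<theta>. ennreal (indicator {0..2*pi} \<theta> * 6 * F \<theta> * (\<theta> + v) powr - 1) +
           ennreal (indicator {0..2*pi} (2*pi - \<theta>) * 6 * F (2*pi - \<theta>) * (2 * pi - (2*pi - \<theta>) + v) powr - 1) \<partial>lborel)"
        by (rule nn_integral_add[symmetric]) auto
      also have "\<dots> = (\<integral>\<^sup>+\<theta>. ennreal 6 * (ennreal (h \<theta> * (\<theta> + v) powr - 1) * indicator {0<..} \<theta>) \<partial>lborel)"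
      proof (rule nn_integral_cong_AE, rule eventually_mono[OF AE_lborel_singleton[of 0]])
        fix \<theta> :: real assume "\<theta> \<noteq> 0"
        let ?k = "(\<theta> + v) powr - 1"
        have "ennreal (6 * F \<theta> * ?k) + ennreal (6 * F (2*pi - \<theta>) * ?k) = ennreal (6 * F \<theta> * ?k + 6 * F (2*pi - \<theta>) * ?k)"
          by (rule ennreal_plus[symmetric]) (auto intro!: mult_nonneg_nonneg F0)
        also have "6 * F \<theta> * ?k + 6 * F (2*pi - \<theta>) * ?k = 6 * ((F \<theta> + F (2*pi - \<theta>)) * ?k)"
          by (simp only: algebra_simps)
        also have "ennreal \<dots> = ennreal 6 * ennreal ((F \<theta> + F (2*pi - \<theta>)) * ?k)"
          by (rule ennreal_mult) (auto intro!: mult_nonneg_nonneg add_nonneg_nonneg F0)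
        finally show "ennreal (indicator {0..2*pi} \<theta> * 6 * F \<theta> * (\<theta> + v) powr - 1) +
            ennreal (indicator {0..2*pi} (2*pi - \<theta>) * 6 * F (2*pi - \<theta>) * (2 * pi - (2*pi - \<theta>) + v) powr - 1)
          = ennreal 6 * (ennreal (h \<theta> * (\<theta> + v) powr - 1) * indicator {0<..} \<theta>)"
          using \<open>\<theta> \<noteq> 0\<close> by (simp add: h_def indicator_def del: ennreal_numeral ennreal_plus)
      qed
      also have "\<dots> = ennreal 6 * (\<integral>\<^sup>+s\<in>{0<..}. ennreal (h s * (s + v) powr - 1) \<partial>lborel)"
        by (rule nn_integral_cmult) measurable
      finally have "ennreal (2 * pi * A v) \<le> ennreal 6 * (\<integral>\<^sup>+s\<in>{0<..}. ennreal (h s * (s + v) powr - 1) \<partial>lborel)" .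
      \<comment> \<open>Since 6 < 2 pi, the kernel constant is absorbed by the 2 pi of Cauchy's
        formula.\<close>
      moreover have "ennreal 6 * ennreal (A v) \<le> ennreal (2 * pi * A v)"
        using pi_gt3 by (subst ennreal_mult[symmetric]) (auto simp: A_def intro!: ennreal_leI mult_right_mono)
      ultimately have "ennreal 6 * ennreal (A v) \<le> ennreal 6 * (\<integral>\<^sup>+s\<in>{0<..}. ennreal (h s * (s + v) powr - 1) \<partial>lborel)"
        by (rule order_trans[rotated])
      then show ?thesis by (simp add: ennreal_mult_le_mult_iff)
    qed (simp add: A_def)
    have hp: "(\<integral>\<^sup>+s\<in>{0<..}. ennreal (h s powr p) \<partial>lborel) \<le> ennreal (2 powr p * 2) * ?M"
    proof -
      have "(\<integral>\<^sup>+s\<in>{0<..}. ennreal (h s powr p) \<partial>lborel)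
         \<le> (\<integral>\<^sup>+s. ennreal (2 powr p) * (ennreal (F s powr p) * indicator {0..2*pi} s + ennreal (F (2*pi - s) powr p) * indicator {0..2*pi} (2*pi - s)) \<partial>lborel)"
      proof (intro nn_integral_mono)
        fix s :: real
        show "ennreal (h s powr p) * indicator {0<..} s \<le> ennreal (2 powr p) * (ennreal (F s powr p) * indicator {0..2*pi} s + ennreal (F (2*pi - s) powr p) * indicator {0..2*pi} (2*pi - s))"
          using powr_add_le[of "F s" "F (2*pi - s)" p] F0 p
          by (auto simp: h_def indicator_def ennreal_mult[symmetric] ennreal_plus[symmetric] ennreal_leI simp del: ennreal_plus)
      qed
      also have "\<dots> = ennreal (2 powr p) * (?M + (\<integral>\<^sup>+s. ennreal (F (2*pi - s) powr p) * indicator {0..2*pi} (2*pi - s) \<partial>lborel))"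
        by (subst nn_integral_cmult, measurable, subst nn_integral_add) auto
      also have "(\<integral>\<^sup>+s. ennreal (F (2*pi - s) powr p) * indicator {0..2*pi} (2*pi - s) \<partial>lborel) = ?M"
        by (rule nn_integral_reflect) measurable
      also have "ennreal (2 powr p) * (?M + ?M) = ennreal (2 powr p * 2) * ?M"
      proof -
        have "ennreal (2 powr p * 2) = ennreal (2 powr p) * 2" by (subst ennreal_mult) auto
        then show ?thesis by (simp only: mult_2[symmetric] mult.assoc)
      qed
      finally show ?thesis .
    qed
    have "(\<integral>\<^sup>+v\<in>{0<..}. ennreal (A v powr p) \<partial>lborel)
      \<le> ennreal C * (\<integral>\<^sup>+s\<in>{0<..}. ennreal (h s powr p) \<partial>lborel)"
    proof -
      have "(\<integral>\<^sup>+v\<in>{0<..}. ennreal (A v powr p * v powr 0) \<partial>lborel)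
      \<le> ennreal C * (\<integral>\<^sup>+s\<in>{0<..}. ennreal (h s powr p * s powr (0 + p * (1 - 1))) \<partial>lborel)"
      proof (rule hilb)
        show "0 \<le> h s" for s by (simp add: h_def F0)
        show "0 \<le> A v" for v by (simp add: A_def)
      qed (use AA in auto)
      moreover have "ennreal (x * y powr 0) * indicator {0<..} y = ennreal x * indicator {0<..} y" for x y :: real
        by (auto simp: indicator_def)
      ultimately show ?thesis by (simp only: diff_self mult_zero_right add_0_left)
    qed
    also have "\<dots> \<le> ennreal C * (ennreal (2 powr p * 2) * ?M)" by (intro mult_left_mono hp) auto
    also have "\<dots> = ennreal D * ?M"
      unfolding D_def using C by (subst ennreal_mult[of C "2 powr p * 2"]) (auto simp: mult.assoc)
    finally have main: "(\<integral>\<^sup>+v\<in>{0<..}. ennreal (A v powr p) \<partial>lborel) \<le> ennreal D * ?M" .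
    let ?g = "\<lambda>u. ennreal (cmod (f (of_real u)) powr p) * indicator {0<..<R} u"
    have [measurable]: "?g \<in> borel_measurable borel"
    proof -
      have "(\<lambda>u. indicator {0<..<R} u *\<^sub>R f (of_real u)) \<in> borel_measurable borel"
        by (intro borel_measurable_continuous_on_indicator
            continuous_on_compose2[OF holomorphic_on_imp_continuous_on[OF f]] continuous_intros)
           (use R in auto)
      then have "(\<lambda>u. ennreal (cmod (indicator {0<..<R} u *\<^sub>R f (of_real u)) powr p)) \<in> borel_measurable borel"
        by measurable
      also have "(\<lambda>u. ennreal (cmod (indicator {0<..<R} u *\<^sub>R f (of_real u)) powr p)) = ?g"
        using p by (auto simp: indicator_def fun_eq_iff)
      finally show ?thesis .
    qed
    \<comment> \<open>The substitution u = R (1 - v) is the source of the factor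
      \<open>R\<close>.\<close>
    have e1: "(\<integral>\<^sup>+u. ?g u \<partial>lborel) = ennreal R * (\<integral>\<^sup>+v. ?g (R + (- R) * v) \<partial>lborel)"
      using nn_integral_real_affine[of ?g "- R" R] R by simp
    have e2: "(\<integral>\<^sup>+v. ?g (R + (- R) * v) \<partial>lborel) \<le> (\<integral>\<^sup>+v\<in>{0<..}. ennreal (A v powr p) \<partial>lborel)"
      by (intro nn_integral_mono) (use R in \<open>auto simp: indicator_def A_def algebra_simps zero_less_mult_iff\<close>)
    have "(\<integral>\<^sup>+u. ?g u \<partial>lborel) \<le> ennreal R * (ennreal D * ?M)"
      unfolding e1 by (intro mult_left_mono order_trans[OF e2 main]) auto
    also have "\<dots> = ennreal (D * R) * ?M"
      using R D0 by (subst ennreal_mult[of D R]) (auto simp: mult.left_commute mult.assoc)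
    finally show "(\<integral>\<^sup>+u\<in>{0<..<R}. ennreal (cmod (f (of_real u)) powr p) \<partial>lborel)
      \<le> ennreal (D * R) * (\<integral>\<^sup>+\<theta>\<in>{0..2*pi}. ennreal (cmod (f (rcis R \<theta>)) powr p) \<partial>lborel)"
      unfolding F_def .
  qed
qed

section \<open>Restriction to a radius\<close>

text \<open>The variable \<open>s\<close> is the distance to the boundary point 1.\<close>

definition radial_modulus :: "(complex \<Rightarrow> complex) \<Rightarrow> real \<Rightarrow> real" where
  "radial_modulus f s = indicator {0<..<1} s * cmod (f (of_real (1 - s)))"

lemma radial_modulus_nonneg: "0 \<le> radial_modulus f s"
  by (simp add: radial_modulus_def)

lemma radial_modulus_measurable:
  assumes f: "f holomorphic_on ball 0 1"
  shows "radial_modulus f \<in> borel_measurable borel"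
proof -
  have "(\<lambda>s. indicator {0<..<1} s *\<^sub>R f (of_real (1 - s))) \<in> borel_measurable borel"
    by (intro borel_measurable_continuous_on_indicator
        continuous_on_compose2[OF holomorphic_on_imp_continuous_on[OF f]] continuous_intros)
       (auto simp del: of_real_diff)
  then have "(\<lambda>s. cmod (indicator {0<..<1} s *\<^sub>R f (of_real (1 - s)))) \<in> borel_measurable borel"
    by measurable
  also have "(\<lambda>s. cmod (indicator {0<..<1} s *\<^sub>R f (of_real (1 - s)))) = radial_modulus f"
    by (auto simp: radial_modulus_def fun_eq_iff indicator_def)
  finally show ?thesis .
qed

text \<open>Fejer--Riesz is available on circles inside the disc; monotone convergence exhausts the
  radius as these circles expand.\<close>

lemma hardy_radial_bound:
  fixes p :: real
  assumes p: "p > 1"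
  shows "\<exists>C>0. \<forall>f M. f holomorphic_on ball 0 1 \<longrightarrow>
    (\<forall>r\<in>{0<..<1}. (\<integral>\<^sup>+\<theta>\<in>{0..2*pi}. ennreal (cmod (f (rcis r \<theta>)) powr p) \<partial>lborel) \<le> M) \<longrightarrow>
    (\<integral>\<^sup>+s\<in>{0<..}. ennreal (radial_modulus f s powr p) \<partial>lborel) \<le> ennreal C * M"
proof -
  obtain C where C: "C > 0" and FR: "\<And>f R. f holomorphic_on ball 0 1 \<Longrightarrow> 0 < R \<Longrightarrow> R < 1 \<Longrightarrow>
    (\<integral>\<^sup>+u\<in>{0<..<R}. ennreal (cmod (f (of_real u)) powr p) \<partial>lborel)
      \<le> ennreal (C * R) * (\<integral>\<^sup>+\<theta>\<in>{0..2*pi}. ennreal (cmod (f (rcis R \<theta>)) powr p) \<partial>lborel)"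
    using fejer_riesz[OF p] by blast
  show ?thesis
  proof (intro exI[of _ C] conjI allI impI C)
    fix f :: "complex \<Rightarrow> complex" and M
    assume f: "f holomorphic_on ball 0 1"
      and M: "\<forall>r\<in>{0<..<1}. (\<integral>\<^sup>+\<theta>\<in>{0..2*pi}. ennreal (cmod (f (rcis r \<theta>)) powr p) \<partial>lborel) \<le> M"
    have [measurable]: "radial_modulus f \<in> borel_measurable borel" by (rule radial_modulus_measurable[OF f])
    let ?\<phi> = "\<lambda>s. ennreal (radial_modulus f s powr p)"
    \<comment> \<open>Starting at 1 / 2 keeps every circle radius \<open>1 - a n\<close> strictly
      between 0 and 1.\<close>
    define a where "a n = 1 / (real n + 2)" for n
    have a: "0 < a n" "a n < 1" for n by (auto simp: a_def)
    have dec: "a n \<le> a m" if "m \<le> n" for m n using that by (auto simp: a_def frac_le)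
    have b: "(\<integral>\<^sup>+s. ?\<phi> s * indicator {a n<..<1} s \<partial>lborel) \<le> ennreal C * M" for n
    proof -
      have "(\<integral>\<^sup>+s. ?\<phi> s * indicator {a n<..<1} s \<partial>lborel)
        = (\<integral>\<^sup>+s. ?\<phi> (1 - s) * indicator {a n<..<1} (1 - s) \<partial>lborel)"
        by (rule nn_integral_reflect[symmetric]) measurable
      also have "\<dots> = (\<integral>\<^sup>+u\<in>{0<..<1 - a n}. ennreal (cmod (f (of_real u)) powr p) \<partial>lborel)"
      proof (intro nn_integral_cong)
        fix u :: real
        show "?\<phi> (1 - u) * indicator {a n<..<1} (1 - u)
          = ennreal (cmod (f (of_real u)) powr p) * indicator {0<..<1 - a n} u"
          using a[of n] by (auto simp: indicator_def radial_modulus_def)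
      qed
      also have "\<dots> \<le> ennreal (C * (1 - a n)) * (\<integral>\<^sup>+\<theta>\<in>{0..2*pi}. ennreal (cmod (f (rcis (1 - a n) \<theta>)) powr p) \<partial>lborel)"
        using a[of n] by (intro FR f) simp_all
      also have "\<dots> \<le> ennreal C * M"
      proof (rule mult_mono)
        show "ennreal (C * (1 - a n)) \<le> ennreal C" using a[of n] C by (intro ennreal_leI mult_left_le) simp_all
        show "(\<integral>\<^sup>+\<theta>\<in>{0..2*pi}. ennreal (cmod (f (rcis (1 - a n) \<theta>)) powr p) \<partial>lborel) \<le> M"
          by (rule M[rule_format]) (use a[of n] in simp)
      qed simp_all
      finally show ?thesis .
    qed
    have "(\<integral>\<^sup>+s\<in>{0<..}. ?\<phi> s \<partial>lborel) = (\<integral>\<^sup>+s. (SUP n. ?\<phi> s * indicator {a n<..<1} s) \<partial>lborel)"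
    proof (intro nn_integral_cong)
      fix s :: real
      show "?\<phi> s * indicator {0<..} s = (SUP n. ?\<phi> s * indicator {a n<..<1} s)"
      proof (cases "0 < s \<and> s < 1")
        case True
        then obtain n where "1 / s < real n" using reals_Archimedean2 by blast
        then have "1 < s * real n" using True by (simp add: field_simps)
        then have "a n < s" using True by (simp add: a_def field_simps)
        then have "?\<phi> s * indicator {0<..} s \<le> ?\<phi> s * indicator {a n<..<1} s" using True by simp
        also have "\<dots> \<le> (SUP n. ?\<phi> s * indicator {a n<..<1} s)" by (rule SUP_upper) simp
        finally have "?\<phi> s * indicator {0<..} s \<le> (SUP n. ?\<phi> s * indicator {a n<..<1} s)" .
        moreover have "?\<phi> s * indicator {a n<..<1} s \<le> ?\<phi> s * indicator {0<..} s" for n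
          using True by (simp add: indicator_def)
        then have "(SUP n. ?\<phi> s * indicator {a n<..<1} s) \<le> ?\<phi> s * indicator {0<..} s"
          by (rule SUP_least)
        ultimately show ?thesis by (rule antisym)
      next
        case False
        then have "?\<phi> s * indicator {0<..} s = 0" using p by (auto simp: radial_modulus_def indicator_def)
        moreover have "?\<phi> s * indicator {a n<..<1} s = 0" for n
          using False a[of n] by (auto simp: indicator_def)
        ultimately show ?thesis by (simp only: SUP_const[OF UNIV_not_empty])
      qed
    qed
    also have "\<dots> = (SUP n. \<integral>\<^sup>+s. ?\<phi> s * indicator {a n<..<1} s \<partial>lborel)"
    proof (rule nn_integral_monotone_convergence_SUP)
      show "incseq (\<lambda>n s. ?\<phi> s * indicator {a n<..<1} s)"
      proof (intro incseq_SucI le_funI mult_left_mono)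
        fix n and s :: real
        show "indicator {a n<..<1} s \<le> (indicator {a (Suc n)<..<1} s :: ennreal)"
          using dec[of n "Suc n"] by (simp add: indicator_def)
      qed simp
    qed measurable
    also have "\<dots> \<le> ennreal C * M" by (intro SUP_least b)
    finally show "(\<integral>\<^sup>+s\<in>{0<..}. ?\<phi> s \<partial>lborel) \<le> ennreal C * M" .
  qed
qed

section \<open>Bergman integrals and the radius\<close>

lemma nn_integral_powr_Ioo:
  fixes s \<alpha> :: real
  assumes "s > 0" "\<alpha> > -1"
  shows "(\<integral>\<^sup>+d\<in>{0<..<s}. ennreal (d powr \<alpha>) \<partial>lborel) = ennreal (s powr (\<alpha> + 1) / (\<alpha> + 1))"
proof -
  have "(\<integral>\<^sup>+d\<in>{0<..<s}. ennreal (d powr \<alpha>) \<partial>lborel) = (\<integral>\<^sup>+d. ennreal (d powr \<alpha>) * indicator {0..s} d \<partial>lborel)"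
    by (rule nn_integral_cong_AE, rule eventually_mono[OF AE_conjI[OF AE_lborel_singleton[of 0] AE_lborel_singleton[of s]]])
       (auto simp: indicator_def)
  also have "\<dots> = ennreal (s powr (\<alpha> + 1) / (\<alpha> + 1))"
    using assms by (intro nn_integral_has_integral_lebesgue' has_integral_powr_from_0) auto
  finally show ?thesis .
qed

text \<open>The quotient of 1 - r^2 and 1 - r is 1 + r, which lies between 1 and 2; the absolute
  value in the exponent lets one constant cover both signs of \<alpha>.\<close>

lemma one_minus_power2_powr_bounds:
  fixes r \<alpha> :: real
  assumes "0 \<le> r" "r < 1"
  shows "(1 - r) powr \<alpha> \<le> 2 powr \<bar>\<alpha>\<bar> * (1 - r\<^sup>2) powr \<alpha>"
    and "(1 - r\<^sup>2) powr \<alpha> \<le> 2 powr \<bar>\<alpha>\<bar> * (1 - r) powr \<alpha>"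
proof -
  have eq: "(1 - r\<^sup>2) powr \<alpha> = (1 - r) powr \<alpha> * (1 + r) powr \<alpha>"
    using assms by (subst powr_mult[symmetric]) (auto simp: algebra_simps power2_eq_square)
  have "(1 + r) powr \<alpha> \<le> (1 + r) powr \<bar>\<alpha>\<bar>" using assms by (intro powr_mono) auto
  also have "\<dots> \<le> 2 powr \<bar>\<alpha>\<bar>" using assms by (intro powr_mono2) auto
  finally show "(1 - r\<^sup>2) powr \<alpha> \<le> 2 powr \<bar>\<alpha>\<bar> * (1 - r) powr \<alpha>"
    unfolding eq by (simp add: mult.commute mult_left_mono)
  have "(1 + r) powr - \<bar>\<alpha>\<bar> \<le> (1 + r) powr \<alpha>" using assms by (intro powr_mono) auto
  moreover have "2 powr - \<bar>\<alpha>\<bar> \<le> (1 + r) powr - \<bar>\<alpha>\<bar>" using assms by (intro powr_mono2') auto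
  ultimately have "2 powr - \<bar>\<alpha>\<bar> \<le> (1 + r) powr \<alpha>" by simp
  then have "1 \<le> 2 powr \<bar>\<alpha>\<bar> * (1 + r) powr \<alpha>" by (simp add: powr_minus field_simps)
  then have "(1 - r) powr \<alpha> * 1 \<le> (1 - r) powr \<alpha> * (2 powr \<bar>\<alpha>\<bar> * (1 + r) powr \<alpha>)"
    by (intro mult_left_mono) auto
  then show "(1 - r) powr \<alpha> \<le> 2 powr \<bar>\<alpha>\<bar> * (1 - r\<^sup>2) powr \<alpha>"
    unfolding eq by (simp add: mult_ac)
qed

text \<open>Extended-valued, so that it can be estimated before membership in the space is known.
  The normalising factor is left to the norm.\<close>

definition bergman_nn_integral :: "real \<Rightarrow> real \<Rightarrow> (complex \<Rightarrow> complex) \<Rightarrow> ennreal" where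
  "bergman_nn_integral p \<alpha> f =
     (\<integral>\<^sup>+z\<in>ball 0 1. ennreal (cmod (f z) powr p * (1 - (cmod z)\<^sup>2) powr \<alpha>) \<partial>lborel)"

lemma holomorphic_unit_disc_measurable:
  assumes f: "f holomorphic_on ball 0 1"
  shows "(\<lambda>z. indicator (ball 0 1) z *\<^sub>R f z) \<in> borel_measurable borel"
  by (intro borel_measurable_continuous_on_indicator holomorphic_on_imp_continuous_on[OF f]) simp

lemma bergman_nn_integral_polar:
  assumes f: "f holomorphic_on ball 0 1" and p: "p > 0"
  shows "bergman_nn_integral p \<alpha> f = (\<integral>\<^sup>+r\<in>{0<..<1}. ennreal (r * (1 - r\<^sup>2) powr \<alpha>) *
     (\<integral>\<^sup>+\<theta>\<in>{0..2*pi}. ennreal (cmod (f (rcis r \<theta>)) powr p) \<partial>lborel) \<partial>lborel)"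
proof -
  \<comment> \<open>Nothing is known about f outside the disc; the cut-off gives a Borel function on
    the whole plane with the same integral.\<close>
  define g where "g z = indicator (ball 0 1) z *\<^sub>R f z" for z
  have [measurable]: "g \<in> borel_measurable borel"
    unfolding g_def by (rule holomorphic_unit_disc_measurable[OF f])
  have "bergman_nn_integral p \<alpha> f
    = (\<integral>\<^sup>+z\<in>ball 0 1. ennreal (cmod (g z) powr p * (1 - (cmod z)\<^sup>2) powr \<alpha>) \<partial>lborel)"
    unfolding bergman_nn_integral_def by (intro nn_integral_cong) (auto simp: g_def indicator_def)
  also have "\<dots> = (\<integral>\<^sup>+r\<in>{0<..<1}. ennreal r * (\<integral>\<^sup>+\<theta>\<in>{0..2*pi}.
      ennreal (cmod (g (rcis r \<theta>)) powr p * (1 - (cmod (rcis r \<theta>))\<^sup>2) powr \<alpha>) \<partial>lborel) \<partial>lborel)"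
    by (rule nn_integral_unit_disc_polar) measurable
  also have "\<dots> = (\<integral>\<^sup>+r\<in>{0<..<1}. ennreal (r * (1 - r\<^sup>2) powr \<alpha>) *
     (\<integral>\<^sup>+\<theta>\<in>{0..2*pi}. ennreal (cmod (f (rcis r \<theta>)) powr p) \<partial>lborel) \<partial>lborel)"
  proof (intro nn_integral_cong)
    fix r :: real
    show "ennreal r * (\<integral>\<^sup>+\<theta>\<in>{0..2*pi}.
      ennreal (cmod (g (rcis r \<theta>)) powr p * (1 - (cmod (rcis r \<theta>))\<^sup>2) powr \<alpha>) \<partial>lborel) * indicator {0<..<1} r
      = ennreal (r * (1 - r\<^sup>2) powr \<alpha>) *
     (\<integral>\<^sup>+\<theta>\<in>{0..2*pi}. ennreal (cmod (f (rcis r \<theta>)) powr p) \<partial>lborel) * indicator {0<..<1} r"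
    proof (cases "0 < r \<and> r < 1")
      case True
      have [measurable]: "(\<lambda>\<theta>. cmod (f (rcis r \<theta>))) \<in> borel_measurable borel"
        using True by (intro circle_norm_measurable[OF f]) auto
      have "(\<integral>\<^sup>+\<theta>\<in>{0..2*pi}.
        ennreal (cmod (g (rcis r \<theta>)) powr p * (1 - (cmod (rcis r \<theta>))\<^sup>2) powr \<alpha>) \<partial>lborel)
       = (\<integral>\<^sup>+\<theta>. ennreal ((1 - r\<^sup>2) powr \<alpha>) * (ennreal (cmod (f (rcis r \<theta>)) powr p) * indicator {0..2*pi} \<theta>) \<partial>lborel)"
        by (intro nn_integral_cong) (use True in \<open>auto simp: g_def indicator_def ennreal_mult mult.commute\<close>)
      also have "\<dots> = ennreal ((1 - r\<^sup>2) powr \<alpha>) * (\<integral>\<^sup>+\<theta>\<in>{0..2*pi}. ennreal (cmod (f (rcis r \<theta>)) powr p) \<partial>lborel)"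
        by (rule nn_integral_cmult) measurable
      finally show ?thesis using True by (simp add: ennreal_mult mult.assoc)
    qed auto
  qed
  finally show ?thesis .
qed

text \<open>The weight is \<alpha> + 1 times the integral of \<open>d powr \<alpha>\<close> over 0 <
  d < s. After exchanging integrals, d = 1 - r leaves the part of the radius from 0 to r, which the
  circle of radius r controls; the factor r in Fejer--Riesz then matches the area element.\<close>

lemma bergman_radial_bound:
  fixes p \<alpha> :: real
  assumes p: "p > 1" and \<alpha>: "\<alpha> > -1"
  shows "\<exists>C>0. \<forall>f. f holomorphic_on ball 0 1 \<longrightarrow>
    (\<integral>\<^sup>+s\<in>{0<..}. ennreal (radial_modulus f s powr p * s powr (\<alpha> + 1)) \<partial>lborel)
      \<le> ennreal C * bergman_nn_integral p \<alpha> f"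
proof -
  obtain C where C: "C > 0" and FR: "\<And>f R. f holomorphic_on ball 0 1 \<Longrightarrow> 0 < R \<Longrightarrow> R < 1 \<Longrightarrow>
    (\<integral>\<^sup>+u\<in>{0<..<R}. ennreal (cmod (f (of_real u)) powr p) \<partial>lborel)
      \<le> ennreal (C * R) * (\<integral>\<^sup>+\<theta>\<in>{0..2*pi}. ennreal (cmod (f (rcis R \<theta>)) powr p) \<partial>lborel)"
    using fejer_riesz[OF p] by blast
  define D where "D = (\<alpha> + 1) * (C * 2 powr \<bar>\<alpha>\<bar>)"
  have D: "D > 0" using \<alpha> C by (simp add: D_def)
  show ?thesis
  proof (intro exI[of _ D] conjI allI impI D)
    fix f :: "complex \<Rightarrow> complex"
    assume f: "f holomorphic_on ball 0 1"
    have [measurable]: "radial_modulus f \<in> borel_measurable borel" by (rule radial_modulus_measurable[OF f])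
    let ?\<phi> = "\<lambda>s. ennreal (radial_modulus f s powr p)"
    let ?M = "\<lambda>r. \<integral>\<^sup>+\<theta>\<in>{0..2*pi}. ennreal (cmod (f (rcis r \<theta>)) powr p) \<partial>lborel"
    have "(\<integral>\<^sup>+s\<in>{0<..}. ennreal (radial_modulus f s powr p * s powr (\<alpha> + 1)) \<partial>lborel)
      = (\<integral>\<^sup>+s. ennreal (\<alpha> + 1) * (\<integral>\<^sup>+d. ?\<phi> s * ennreal (d powr \<alpha>) * indicator {0<..<s} d * indicator {0<..<1} s \<partial>lborel) \<partial>lborel)"
    proof (intro nn_integral_cong)
      fix s :: real
      show "ennreal (radial_modulus f s powr p * s powr (\<alpha> + 1)) * indicator {0<..} s
        = ennreal (\<alpha> + 1) * (\<integral>\<^sup>+d. ?\<phi> s * ennreal (d powr \<alpha>) * indicator {0<..<s} d * indicator {0<..<1} s \<partial>lborel)"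
      proof (cases "0 < s \<and> s < 1")
        case True
        have "(\<integral>\<^sup>+d. ?\<phi> s * ennreal (d powr \<alpha>) * indicator {0<..<s} d * indicator {0<..<1} s \<partial>lborel)
          = ?\<phi> s * ennreal (s powr (\<alpha> + 1) / (\<alpha> + 1))"
          using True by (simp add: mult.assoc nn_integral_cmult nn_integral_powr_Ioo \<alpha>)
        then show ?thesis using True \<alpha> by (simp add: ennreal_mult[symmetric])
      next
        case False
        then show ?thesis using p by (auto simp: radial_modulus_def indicator_def)
      qed
    qed
    also have "\<dots> = ennreal (\<alpha> + 1) * (\<integral>\<^sup>+s. (\<integral>\<^sup>+d. ?\<phi> s * ennreal (d powr \<alpha>) * indicator {0<..<s} d * indicator {0<..<1} s \<partial>lborel) \<partial>lborel)"
      by (rule nn_integral_cmult) (simp add: indicator_def)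
    finally have eq: "(\<integral>\<^sup>+s\<in>{0<..}. ennreal (radial_modulus f s powr p * s powr (\<alpha> + 1)) \<partial>lborel)
      = ennreal (\<alpha> + 1) * (\<integral>\<^sup>+s. (\<integral>\<^sup>+d. ?\<phi> s * ennreal (d powr \<alpha>) * indicator {0<..<s} d * indicator {0<..<1} s \<partial>lborel) \<partial>lborel)" .
    have "(\<integral>\<^sup>+s. (\<integral>\<^sup>+d. ?\<phi> s * ennreal (d powr \<alpha>) * indicator {0<..<s} d * indicator {0<..<1} s \<partial>lborel) \<partial>lborel)
       = (\<integral>\<^sup>+d. (\<integral>\<^sup>+s. ?\<phi> s * ennreal (d powr \<alpha>) * indicator {0<..<s} d * indicator {0<..<1} s \<partial>lborel) \<partial>lborel)"
      by (rule lborel_pair.Fubini') (simp add: indicator_def case_prod_unfold)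
    also have "\<dots> = (\<integral>\<^sup>+r. (\<integral>\<^sup>+s. ?\<phi> s * ennreal ((1 - r) powr \<alpha>) * indicator {0<..<s} (1 - r) * indicator {0<..<1} s \<partial>lborel) \<partial>lborel)"
      by (rule nn_integral_reflect[symmetric]) (simp add: indicator_def)
    also have "\<dots> \<le> (\<integral>\<^sup>+r. ennreal (C * 2 powr \<bar>\<alpha>\<bar>) * (ennreal (r * (1 - r\<^sup>2) powr \<alpha>) * ?M r * indicator {0<..<1} r) \<partial>lborel)"
    proof (intro nn_integral_mono)
      fix r :: real
      show "(\<integral>\<^sup>+s. ?\<phi> s * ennreal ((1 - r) powr \<alpha>) * indicator {0<..<s} (1 - r) * indicator {0<..<1} s \<partial>lborel)
        \<le> ennreal (C * 2 powr \<bar>\<alpha>\<bar>) * (ennreal (r * (1 - r\<^sup>2) powr \<alpha>) * ?M r * indicator {0<..<1} r)"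
      proof (cases "0 < r \<and> r < 1")
        case True
        have "(\<integral>\<^sup>+s. ?\<phi> s * ennreal ((1 - r) powr \<alpha>) * indicator {0<..<s} (1 - r) * indicator {0<..<1} s \<partial>lborel)
          = (\<integral>\<^sup>+s. ennreal ((1 - r) powr \<alpha>) * (?\<phi> s * indicator {1 - r<..<1} s) \<partial>lborel)"
          by (intro nn_integral_cong) (use True in \<open>auto simp: indicator_def mult.commute\<close>)
        also have "\<dots> = ennreal ((1 - r) powr \<alpha>) * (\<integral>\<^sup>+s. ?\<phi> s * indicator {1 - r<..<1} s \<partial>lborel)"
          by (rule nn_integral_cmult) measurable
        also have "(\<integral>\<^sup>+s. ?\<phi> s * indicator {1 - r<..<1} s \<partial>lborel)
          = (\<integral>\<^sup>+s. ?\<phi> (1 - s) * indicator {1 - r<..<1} (1 - s) \<partial>lborel)"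
          by (rule nn_integral_reflect[symmetric]) measurable
        also have "\<dots> = (\<integral>\<^sup>+u\<in>{0<..<r}. ennreal (cmod (f (of_real u)) powr p) \<partial>lborel)"
          by (intro nn_integral_cong) (use True in \<open>auto simp: indicator_def radial_modulus_def\<close>)
        also have "ennreal ((1 - r) powr \<alpha>) * \<dots> \<le> ennreal (2 powr \<bar>\<alpha>\<bar> * (1 - r\<^sup>2) powr \<alpha>) * (ennreal (C * r) * ?M r)"
          using True by (intro mult_mono ennreal_leI one_minus_power2_powr_bounds FR f) auto
        also have "\<dots> = ennreal (C * 2 powr \<bar>\<alpha>\<bar>) * (ennreal (r * (1 - r\<^sup>2) powr \<alpha>) * ?M r)"
          using True C by (simp add: ennreal_mult mult_ac)
        finally show ?thesis using True by simp
      next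
        case False
        then have "?\<phi> s * ennreal ((1 - r) powr \<alpha>) * indicator {0<..<s} (1 - r) * indicator {0<..<1} s = 0" for s
          by (auto simp: indicator_def)
        then have "(\<integral>\<^sup>+s. ?\<phi> s * ennreal ((1 - r) powr \<alpha>) * indicator {0<..<s} (1 - r) * indicator {0<..<1} s \<partial>lborel) = 0"
          by (simp only: nn_integral_const mult_zero_left)
        then show ?thesis by (simp only: zero_le)
      qed
    qed
    also have "\<dots> = ennreal (C * 2 powr \<bar>\<alpha>\<bar>) * bergman_nn_integral p \<alpha> f"
    proof -
      define g where "g z = indicator (ball 0 1) z *\<^sub>R f z" for z
      have [measurable]: "g \<in> borel_measurable borel"
        unfolding g_def by (rule holomorphic_unit_disc_measurable[OF f])
      have [measurable]: "(\<lambda>(r, \<theta>). rcis r \<theta>) \<in> borel_measurable (borel \<Otimes>\<^sub>M borel)"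
        by (simp add: borel_prod[symmetric] case_prod_unfold rcis_def cis_conv_exp)
      have "(\<lambda>r. ennreal (r * (1 - r\<^sup>2) powr \<alpha>) * (\<integral>\<^sup>+\<theta>\<in>{0..2*pi}. ennreal (cmod (g (rcis r \<theta>)) powr p) \<partial>lborel) * indicator {0<..<1} r) \<in> borel_measurable lborel"
        by measurable
      also have "(\<lambda>r. ennreal (r * (1 - r\<^sup>2) powr \<alpha>) * (\<integral>\<^sup>+\<theta>\<in>{0..2*pi}. ennreal (cmod (g (rcis r \<theta>)) powr p) \<partial>lborel) * indicator {0<..<1} r)
         = (\<lambda>r. ennreal (r * (1 - r\<^sup>2) powr \<alpha>) * ?M r * indicator {0<..<1} r)"
        by (auto simp: fun_eq_iff indicator_def g_def)
      finally show ?thesis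
        using p by (subst nn_integral_cmult) (auto simp: bergman_nn_integral_polar[OF f])
    qed
    finally show "(\<integral>\<^sup>+s\<in>{0<..}. ennreal (radial_modulus f s powr p * s powr (\<alpha> + 1)) \<partial>lborel)
      \<le> ennreal D * bergman_nn_integral p \<alpha> f"
      using \<alpha> C unfolding D_def eq
      by (subst ennreal_mult[of "\<alpha> + 1"]) (auto intro: mult_left_mono simp: mult.assoc)
  qed
qed

section \<open>From the derivative to the function, and integrability along the radius\<close>

lemma radial_hardy_inequality:
  fixes p \<beta> :: real
  assumes p: "p > 1" and \<beta>: "\<beta> > -1" "\<beta> + 1 < p"
  shows "\<exists>C>0. \<forall>f. f holomorphic_on ball 0 1 \<longrightarrow>
    (\<integral>\<^sup>+s\<in>{0<..}. ennreal (radial_modulus f s powr p * s powr \<beta>) \<partial>lborel)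
      \<le> ennreal C * (ennreal (cmod (f 0) powr p) +
          (\<integral>\<^sup>+s\<in>{0<..}. ennreal (radial_modulus (deriv f) s powr p * s powr (\<beta> + p)) \<partial>lborel))"
proof -
  obtain C where C: "C > 0" and hilb: "\<And>h A. h \<in> borel_measurable borel \<Longrightarrow> (\<And>s. 0 \<le> h s) \<Longrightarrow> (\<And>v. v > 0 \<Longrightarrow> 0 \<le> A v) \<Longrightarrow>
    (\<And>v. v > 0 \<Longrightarrow> ennreal (A v) \<le> (\<integral>\<^sup>+s\<in>{0<..}. ennreal (h s * (s + v) powr - 1) \<partial>lborel)) \<Longrightarrow>
    (\<integral>\<^sup>+v\<in>{0<..}. ennreal (A v powr p * v powr \<beta>) \<partial>lborel)
      \<le> ennreal C * (\<integral>\<^sup>+s\<in>{0<..}. ennreal (h s powr p * s powr (\<beta> + p * (1 - 1))) \<partial>lborel)"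
    using weighted_hilbert_inequality[of p \<beta> 1] p \<beta> by auto
  \<comment> \<open>The outer \<open>2 powr p\<close> splits f into f(0) and f - f(0). The integral
    of \<open>s powr \<beta>\<close> over (0, 1) is \<open>1 / (\<beta> + 1)\<close>, and
    \<open>C * 2 powr p\<close> is the Hilbert constant together with the factor 2 in
    \<open>h\<close>.\<close>
  define D where "D = 2 powr p * max (1 / (\<beta> + 1)) (C * 2 powr p)"
  have D: "D > 0" using \<beta> by (simp add: D_def less_max_iff_disj)
  show ?thesis
  proof (intro exI[of _ D] conjI allI impI D)
    fix f :: "complex \<Rightarrow> complex"
    assume f: "f holomorphic_on ball 0 1"
    then have f': "deriv f holomorphic_on ball 0 1" by (intro holomorphic_deriv) auto
    have [measurable]: "radial_modulus f \<in> borel_measurable borel" "radial_modulus (deriv f) \<in> borel_measurable borel"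
      by (auto intro: radial_modulus_measurable f f')
    \<comment> \<open>The factor \<open>y\<close> raises the weight on the derivative from \<beta>
      to \<beta> + p; the 2 compensates the kernel on the range from s to 1.\<close>
    define h where "h y = 2 * indicator {0<..<1} y * y * radial_modulus (deriv f) y" for y :: real
    have [measurable]: "h \<in> borel_measurable borel" unfolding h_def by measurable
    have h0: "0 \<le> h y" for y
      using radial_modulus_nonneg[of "deriv f" y] by (simp add: h_def indicator_def)
    define A where "A s = indicator {0<..<1} s * cmod (f (of_real (1 - s)) - f 0)" for s
    have [measurable]: "A \<in> borel_measurable borel"
    proof -
      have "(\<lambda>z. f z - f 0) holomorphic_on ball 0 1" by (intro holomorphic_intros f)
      from radial_modulus_measurable[OF this] show ?thesis
        unfolding A_def radial_modulus_def .
    qed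
    have A: "ennreal (A s) \<le> (\<integral>\<^sup>+y\<in>{0<..}. ennreal (h y * (y + s) powr - 1) \<partial>lborel)" if s: "s > 0" for s
    proof (cases "s < 1")
      case True
      have der: "((\<lambda>u. f (of_real u)) has_vector_derivative deriv f (of_real u)) (at u within {0..1 - s})"
        if "u \<in> {0..1 - s}" for u
      proof (rule has_vector_derivative_real_field)
        have "complex_of_real u \<in> ball 0 1" using that s by simp
        then show "(f has_field_derivative deriv f (of_real u)) (at (of_real u))"
          using f holomorphic_derivI open_ball by blast
      qed
      have hi: "((\<lambda>u. deriv f (of_real u)) has_integral (f (of_real (1 - s)) - f (of_real 0))) {0..1 - s}"
        by (rule fundamental_theorem_of_calculus) (use der True in auto)
      have "continuous_on {0..1 - s} (\<lambda>u. deriv f (of_real u))"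
        by (intro continuous_on_compose2[OF holomorphic_on_imp_continuous_on[OF f']] continuous_intros)
           (use s in auto)
      then have si: "set_integrable lborel {0..1 - s} (\<lambda>u. deriv f (of_real u))"
        by (rule borel_integrable_atLeastAtMost')
      have "A s = cmod (LINT u:{0..1 - s}|lborel. deriv f (of_real u))"
        using set_borel_integral_eq_integral(2)[OF si] integral_unique[OF hi] s True
        by (simp add: A_def)
      then have "ennreal (A s) \<le> (\<integral>\<^sup>+u. ennreal (cmod (indicator {0..1 - s} u *\<^sub>R deriv f (of_real u))) \<partial>lborel)"
        unfolding set_lebesgue_integral_def
        using integral_norm_bound_ennreal[of lborel "\<lambda>u. indicator {0..1 - s} u *\<^sub>R deriv f (of_real u)"] si
        by (simp add: set_integrable_def)
      also have "\<dots> = (\<integral>\<^sup>+u. ennreal (radial_modulus (deriv f) (1 - u)) * indicator {s..} (1 - u) \<partial>lborel)"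
        by (rule nn_integral_cong_AE, rule eventually_mono[OF AE_lborel_singleton[of 0]])
           (use s in \<open>auto simp: indicator_def radial_modulus_def\<close>)
      also have "\<dots> = (\<integral>\<^sup>+y. ennreal (radial_modulus (deriv f) y) * indicator {s..} y \<partial>lborel)"
        by (rule nn_integral_reflect) measurable
      also have "\<dots> \<le> (\<integral>\<^sup>+y\<in>{0<..}. ennreal (h y * (y + s) powr - 1) \<partial>lborel)"
      proof (rule nn_integral_mono)
        fix y :: real
        show "ennreal (radial_modulus (deriv f) y) * indicator {s..} y
          \<le> ennreal (h y * (y + s) powr - 1) * indicator {0<..} y"
        proof (cases "s \<le> y \<and> y < 1")
          case True
          have "radial_modulus (deriv f) y * 1 \<le> radial_modulus (deriv f) y * (2 * y * (y + s) powr - 1)"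
            using True s by (intro mult_left_mono radial_modulus_nonneg) (auto simp: powr_minus divide_simps)
          also have "\<dots> = h y * (y + s) powr - 1"
            using True s by (simp add: h_def)
          finally show ?thesis using True s by (simp add: ennreal_leI)
        qed (auto simp: indicator_def radial_modulus_def)
      qed
      finally show ?thesis .
    qed (simp add: A_def)
    let ?R = "\<integral>\<^sup>+s\<in>{0<..}. ennreal (radial_modulus (deriv f) s powr p * s powr (\<beta> + p)) \<partial>lborel"
    have "(\<integral>\<^sup>+v\<in>{0<..}. ennreal (A v powr p * v powr \<beta>) \<partial>lborel)
      \<le> ennreal C * (\<integral>\<^sup>+s\<in>{0<..}. ennreal (h s powr p * s powr (\<beta> + p * (1 - 1))) \<partial>lborel)"
    proof (rule hilb)
      show "0 \<le> A v" for v by (simp add: A_def)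
    qed (use A h0 in auto)
    also have "(\<integral>\<^sup>+s\<in>{0<..}. ennreal (h s powr p * s powr (\<beta> + p * (1 - 1))) \<partial>lborel)
      = (\<integral>\<^sup>+s. ennreal (2 powr p) * (ennreal (radial_modulus (deriv f) s powr p * s powr (\<beta> + p)) * indicator {0<..} s) \<partial>lborel)"
    proof (rule nn_integral_cong)
      fix s :: real
      show "ennreal (h s powr p * s powr (\<beta> + p * (1 - 1))) * indicator {0<..} s
        = ennreal (2 powr p) * (ennreal (radial_modulus (deriv f) s powr p * s powr (\<beta> + p)) * indicator {0<..} s)"
      proof (cases "0 < s \<and> s < 1")
        case True
        then have "h s powr p * s powr \<beta> = 2 powr p * (radial_modulus (deriv f) s powr p * s powr (\<beta> + p))"
          using radial_modulus_nonneg[of "deriv f" s] by (simp add: h_def powr_mult powr_add)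
        then show ?thesis using True by (simp add: ennreal_mult[symmetric])
      qed (use p in \<open>auto simp: h_def indicator_def radial_modulus_def\<close>)
    qed
    also have "\<dots> = ennreal (2 powr p) * ?R" by (rule nn_integral_cmult) measurable
    finally have 1: "(\<integral>\<^sup>+v\<in>{0<..}. ennreal (A v powr p * v powr \<beta>) \<partial>lborel) \<le> ennreal (C * 2 powr p) * ?R"
      using C by (simp add: ennreal_mult mult.assoc)
    have "(\<integral>\<^sup>+s\<in>{0<..}. ennreal (radial_modulus f s powr p * s powr \<beta>) \<partial>lborel)
      \<le> (\<integral>\<^sup>+s. ennreal (2 powr p) * (ennreal (cmod (f 0) powr p) * (ennreal (s powr \<beta>) * indicator {0<..<1} s)
           + ennreal (A s powr p * s powr \<beta>) * indicator {0<..} s) \<partial>lborel)"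
    proof (rule nn_integral_mono)
      fix s :: real
      show "ennreal (radial_modulus f s powr p * s powr \<beta>) * indicator {0<..} s
        \<le> ennreal (2 powr p) * (ennreal (cmod (f 0) powr p) * (ennreal (s powr \<beta>) * indicator {0<..<1} s)
           + ennreal (A s powr p * s powr \<beta>) * indicator {0<..} s)"
      proof (cases "0 < s \<and> s < 1")
        case True
        have "radial_modulus f s \<le> cmod (f 0) + A s"
          using True norm_triangle_ineq[of "f 0" "f (of_real (1 - s)) - f 0"] by (simp add: radial_modulus_def A_def)
        then have "radial_modulus f s powr p \<le> (cmod (f 0) + A s) powr p"
          using p radial_modulus_nonneg[of f s] by (intro powr_mono2) auto
        also have "\<dots> \<le> 2 powr p * (cmod (f 0) powr p + A s powr p)"
          using p by (intro powr_add_le) (auto simp: A_def)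
        finally have "radial_modulus f s powr p * s powr \<beta> \<le> 2 powr p * (cmod (f 0) powr p + A s powr p) * s powr \<beta>"
          by (intro mult_right_mono) auto
        also have "\<dots> = 2 powr p * (cmod (f 0) powr p * s powr \<beta> + A s powr p * s powr \<beta>)"
          by (simp add: algebra_simps)
        finally show ?thesis
          using True by (simp add: ennreal_mult[symmetric] ennreal_plus[symmetric] ennreal_leI del: ennreal_plus)
      qed (use p in \<open>auto simp: radial_modulus_def indicator_def\<close>)
    qed
    also have "\<dots> = ennreal (2 powr p) * (ennreal (cmod (f 0) powr p) * (\<integral>\<^sup>+s\<in>{0<..<1}. ennreal (s powr \<beta>) \<partial>lborel)
           + (\<integral>\<^sup>+s\<in>{0<..}. ennreal (A s powr p * s powr \<beta>) \<partial>lborel))"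
      by (subst nn_integral_cmult, measurable, subst nn_integral_add, measurable, subst nn_integral_cmult) auto
    also have "\<dots> \<le> ennreal (2 powr p) * (ennreal (cmod (f 0) powr p) * ennreal (max (1 / (\<beta> + 1)) (C * 2 powr p))
           + ennreal (max (1 / (\<beta> + 1)) (C * 2 powr p)) * ?R)"
    proof (intro mult_left_mono add_mono)
      show "(\<integral>\<^sup>+s\<in>{0<..<1}. ennreal (s powr \<beta>) \<partial>lborel) \<le> ennreal (max (1 / (\<beta> + 1)) (C * 2 powr p))"
        using nn_integral_powr_Ioo[of 1 \<beta>] \<beta> by (simp add: ennreal_leI)
      have "ennreal (C * 2 powr p) * ?R \<le> ennreal (max (1 / (\<beta> + 1)) (C * 2 powr p)) * ?R"
        by (intro mult_right_mono ennreal_leI) auto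
      with 1 show "(\<integral>\<^sup>+s\<in>{0<..}. ennreal (A s powr p * s powr \<beta>) \<partial>lborel)
          \<le> ennreal (max (1 / (\<beta> + 1)) (C * 2 powr p)) * ?R"
        by (rule order_trans)
    qed auto
    also have "\<dots> = ennreal D * (ennreal (cmod (f 0) powr p) + ?R)"
    proof -
      have "ennreal D = ennreal (2 powr p) * ennreal (max (1 / (\<beta> + 1)) (C * 2 powr p))"
        unfolding D_def using \<beta> C by (intro ennreal_mult) (auto simp: le_max_iff_disj)
      then show ?thesis by (simp only: distrib_left mult.assoc mult.commute mult.left_commute)
    qed
    finally show "(\<integral>\<^sup>+s\<in>{0<..}. ennreal (radial_modulus f s powr p * s powr \<beta>) \<partial>lborel)
      \<le> ennreal D * (ennreal (cmod (f 0) powr p) + ?R)" .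
  qed
qed

text \<open>A Hoelder inequality drawn from the Hilbert inequality: for s and v in (0, 1) the kernel
  1 / (s + v) is at least 1 / 2, so half the L1 norm bounds the transform from below by a constant.
  The number \<open>a\<close> stands for that norm, which is not yet known to be finite.\<close>

lemma weighted_Lp_imp_L1:
  fixes p \<beta> :: real
  assumes p: "p > 1" and \<beta>: "\<beta> > -1" "\<beta> + 1 < p"
  shows "\<exists>C>0. \<forall>g. g \<in> borel_measurable borel \<longrightarrow> (\<forall>s. 0 \<le> g s) \<longrightarrow> (\<forall>s. s \<notin> {0<..<1} \<longrightarrow> g s = 0) \<longrightarrow>
    (\<forall>a\<ge>0. ennreal a \<le> (\<integral>\<^sup>+s. ennreal (g s) \<partial>lborel) \<longrightarrow>
       ennreal (a powr p) \<le> ennreal C * (\<integral>\<^sup>+s\<in>{0<..}. ennreal (g s powr p * s powr \<beta>) \<partial>lborel))"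
proof -
  obtain C where C: "C > 0" and hilb: "\<And>h A. h \<in> borel_measurable borel \<Longrightarrow> (\<And>s. 0 \<le> h s) \<Longrightarrow> (\<And>v. v > 0 \<Longrightarrow> 0 \<le> A v) \<Longrightarrow>
    (\<And>v. v > 0 \<Longrightarrow> ennreal (A v) \<le> (\<integral>\<^sup>+s\<in>{0<..}. ennreal (h s * (s + v) powr - 1) \<partial>lborel)) \<Longrightarrow>
    (\<integral>\<^sup>+v\<in>{0<..}. ennreal (A v powr p * v powr \<beta>) \<partial>lborel)
      \<le> ennreal C * (\<integral>\<^sup>+s\<in>{0<..}. ennreal (h s powr p * s powr (\<beta> + p * (1 - 1))) \<partial>lborel)"
    using weighted_hilbert_inequality[of p \<beta> 1] p \<beta> by auto
  \<comment> \<open>Undoes the value \<open>(a / 2) powr p / (\<beta> + 1)\<close> of the integral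
    of the constant test function.\<close>
  define D where "D = 2 powr p * (\<beta> + 1)"
  have D: "D > 0" using \<beta> by (simp add: D_def)
  show ?thesis
  proof (intro exI[of _ "D * C"] conjI allI impI)
    show "D * C > 0" using D C by simp
    fix g :: "real \<Rightarrow> real" and a :: real
    assume [measurable]: "g \<in> borel_measurable borel" and g0: "\<forall>s. 0 \<le> g s" and supp: "\<forall>s. s \<notin> {0<..<1} \<longrightarrow> g s = 0"
      and a: "a \<ge> 0" "ennreal a \<le> (\<integral>\<^sup>+s. ennreal (g s) \<partial>lborel)"
    define A where "A v = (if v < 1 then a / 2 else 0)" for v :: real
    have A: "ennreal (A v) \<le> (\<integral>\<^sup>+s\<in>{0<..}. ennreal (g s * (s + v) powr - 1) \<partial>lborel)" if v: "v > 0" for v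
    proof (cases "v < 1")
      case True
      have "A v = 1 / 2 * a" using True by (simp add: A_def)
      then have "ennreal (A v) = ennreal (1 / 2) * ennreal a" using a by (simp only: ennreal_mult)
      also have "\<dots> \<le> ennreal (1 / 2) * (\<integral>\<^sup>+s. ennreal (g s) \<partial>lborel)" by (intro mult_left_mono a) auto
      also have "\<dots> = (\<integral>\<^sup>+s. ennreal (1 / 2) * ennreal (g s) \<partial>lborel)" by (rule nn_integral_cmult[symmetric]) measurable
      also have "\<dots> \<le> (\<integral>\<^sup>+s\<in>{0<..}. ennreal (g s * (s + v) powr - 1) \<partial>lborel)"
      proof (rule nn_integral_mono)
        fix s :: real
        show "ennreal (1 / 2) * ennreal (g s) \<le> ennreal (g s * (s + v) powr - 1) * indicator {0<..} s"
        proof (cases "s \<in> {0<..<1}")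
          case s: True
          have "g s * (1 / 2) \<le> g s * (s + v) powr - 1"
            using s v True g0 by (intro mult_left_mono) (auto simp: powr_minus divide_simps)
          then have "ennreal (g s * (1 / 2)) \<le> ennreal (g s * (s + v) powr - 1)" by (rule ennreal_leI)
          moreover have "ennreal (g s * (1 / 2)) = ennreal (1 / 2) * ennreal (g s)"
            using g0 by (subst mult.commute, intro ennreal_mult) auto
          ultimately show ?thesis using s by simp
        qed (use supp in auto)
      qed
      finally show ?thesis .
    qed (simp add: A_def)
    have "ennreal (a powr p) = ennreal (D * ((a / 2) powr p * (1 / (\<beta> + 1))))"
      using a \<beta> by (simp add: D_def powr_divide)
    also have "\<dots> = ennreal D * (ennreal ((a / 2) powr p) * (\<integral>\<^sup>+v\<in>{0<..<1}. ennreal (v powr \<beta>) \<partial>lborel))"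
    proof -
      have "(\<integral>\<^sup>+v\<in>{0<..<1}. ennreal (v powr \<beta>) \<partial>lborel) = ennreal (1 / (\<beta> + 1))"
        using nn_integral_powr_Ioo[of 1 \<beta>] \<beta> by simp
      then show ?thesis using D \<beta> by (simp add: ennreal_mult[symmetric])
    qed
    also have "ennreal ((a / 2) powr p) * (\<integral>\<^sup>+v\<in>{0<..<1}. ennreal (v powr \<beta>) \<partial>lborel)
      = (\<integral>\<^sup>+v. ennreal ((a / 2) powr p) * (ennreal (v powr \<beta>) * indicator {0<..<1} v) \<partial>lborel)"
      by (rule nn_integral_cmult[symmetric]) measurable
    also have "\<dots> = (\<integral>\<^sup>+v\<in>{0<..}. ennreal (A v powr p * v powr \<beta>) \<partial>lborel)"
    proof (rule nn_integral_cong)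
      fix v :: real
      show "ennreal ((a / 2) powr p) * (ennreal (v powr \<beta>) * indicator {0<..<1} v)
        = ennreal (A v powr p * v powr \<beta>) * indicator {0<..} v"
        using p by (cases "0 < v \<and> v < 1") (simp add: A_def ennreal_mult[symmetric], auto simp: A_def indicator_def)
    qed
    also have "ennreal D * (\<integral>\<^sup>+v\<in>{0<..}. ennreal (A v powr p * v powr \<beta>) \<partial>lborel)
      \<le> ennreal D * (ennreal C * (\<integral>\<^sup>+s\<in>{0<..}. ennreal (g s powr p * s powr (\<beta> + p * (1 - 1))) \<partial>lborel))"
    proof (intro mult_left_mono hilb)
      show "0 \<le> A v" for v using a by (simp add: A_def)
    qed (use A g0 in auto)
    also have "\<dots> = ennreal (D * C) * (\<integral>\<^sup>+s\<in>{0<..}. ennreal (g s powr p * s powr \<beta>) \<partial>lborel)"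
      using D C by (subst ennreal_mult[of D C]) (simp_all add: mult.assoc)
    finally show "ennreal (a powr p) \<le> ennreal (D * C) * (\<integral>\<^sup>+s\<in>{0<..}. ennreal (g s powr p * s powr \<beta>) \<partial>lborel)" .
  qed
qed

text \<open>For infinite \<open>I\<close> every nonnegative a would be admissible, and some p-th
  power exceeds the finite bound \<open>J\<close>.\<close>

lemma nn_integral_finite_of_powr_bound:
  fixes p :: real and I J :: ennreal
  assumes p: "p > 0" and J: "J < \<infinity>" and le: "\<And>a. a \<ge> 0 \<Longrightarrow> ennreal a \<le> I \<Longrightarrow> ennreal (a powr p) \<le> J"
  shows "I < \<infinity>"
proof (rule ccontr)
  assume "\<not> I < \<infinity>"
  then have I: "I = \<infinity>" by (cases I) auto
  obtain j where j: "J = ennreal j" "j \<ge> 0" using J by (cases J) auto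
  have "ennreal (((j + 1) powr (1 / p)) powr p) \<le> ennreal j" using le[of "(j + 1) powr (1 / p)"] I j by simp
  then show False using p j by (simp add: powr_powr)
qed

section \<open>Functions dominated by a Cauchy type integral\<close>

text \<open>The generalised Stieltjes transform of order c. It is real-valued so that
  \<open>powr\<close> applies; a divergent integral is sent to 0, which keeps the upper bound by the
  integral true.\<close>

definition stieltjes_transform :: "real \<Rightarrow> (real \<Rightarrow> real) \<Rightarrow> real \<Rightarrow> real" where
  "stieltjes_transform c g v = enn2real (\<integral>\<^sup>+s\<in>{0<..}. ennreal (g s * (s + v) powr - c) \<partial>lborel)"

lemma stieltjes_transform_measurable:
  assumes [measurable]: "g \<in> borel_measurable borel"
  shows "stieltjes_transform c g \<in> borel_measurable borel"
  unfolding stieltjes_transform_def by measurable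

lemma ennreal_stieltjes_transform_le:
  "ennreal (stieltjes_transform c g v) \<le> (\<integral>\<^sup>+s\<in>{0<..}. ennreal (g s * (s + v) powr - c) \<partial>lborel)"
  unfolding stieltjes_transform_def
  by (cases "(\<integral>\<^sup>+s\<in>{0<..}. ennreal (g s * (s + v) powr - c) \<partial>lborel)") auto

text \<open>The kernel is at most \<open>v powr - c\<close>, so integrability of g rules out the
  default value of \<open>enn2real\<close>.\<close>

lemma ennreal_stieltjes_transform:
  assumes [measurable]: "g \<in> borel_measurable borel" and g: "\<And>s. 0 \<le> g s"
    and fin: "(\<integral>\<^sup>+s. ennreal (g s) \<partial>lborel) < \<infinity>" and c: "c \<ge> 0" and v: "v > 0"
  shows "ennreal (stieltjes_transform c g v) = (\<integral>\<^sup>+s\<in>{0<..}. ennreal (g s * (s + v) powr - c) \<partial>lborel)"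
proof -
  have "(\<integral>\<^sup>+s\<in>{0<..}. ennreal (g s * (s + v) powr - c) \<partial>lborel) \<le> (\<integral>\<^sup>+s. ennreal (v powr - c) * ennreal (g s) \<partial>lborel)"
  proof (rule nn_integral_mono)
    fix s :: real
    show "ennreal (g s * (s + v) powr - c) * indicator {0<..} s \<le> ennreal (v powr - c) * ennreal (g s)"
    proof (cases "s > 0")
      case True
      then have "g s * (s + v) powr - c \<le> g s * v powr - c"
        using v c g by (intro mult_left_mono powr_mono2') auto
      then show ?thesis using True g[of s] by (simp add: ennreal_mult[symmetric] ennreal_leI mult.commute)
    qed simp
  qed
  also have "\<dots> = ennreal (v powr - c) * (\<integral>\<^sup>+s. ennreal (g s) \<partial>lborel)" by (rule nn_integral_cmult) measurable
  also have "\<dots> < \<infinity>" using fin by (simp add: ennreal_mult_less_top)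
  finally show ?thesis unfolding stieltjes_transform_def by simp
qed

text \<open>Treats the operator (c = 1) and its derivative (c = 2) together, with the modulus of f
  on the radius as \<open>g\<close>.\<close>

locale cauchy_type_bound =
  fixes g :: "real \<Rightarrow> real" and c :: real and U :: "complex \<Rightarrow> complex"
  assumes g_meas [measurable]: "g \<in> borel_measurable borel"
    and g_nonneg: "\<And>s. 0 \<le> g s" and g_supp: "\<And>s. s \<notin> {0<..<1} \<Longrightarrow> g s = 0"
    and g_fin: "(\<integral>\<^sup>+s. ennreal (g s) \<partial>lborel) < \<infinity>" and c_pos: "c > 0"
    and U_le: "\<And>z. z \<in> ball 0 1 \<Longrightarrow>
      ennreal (cmod (U z)) \<le> (\<integral>\<^sup>+s. ennreal (g s * cmod (1 - of_real (1 - s) * z) powr - c) \<partial>lborel)"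
begin

abbreviation "A \<equiv> stieltjes_transform c g"

lemma A_measurable [measurable]: "A \<in> borel_measurable borel"
  by (rule stieltjes_transform_measurable[OF g_meas])

lemma A_nonneg: "0 \<le> A v"
  by (simp add: stieltjes_transform_def)

lemma pointwise_bound:
  assumes r: "0 \<le> r" "r < 1" and \<theta>: "0 \<le> \<theta>" "\<theta> \<le> 2 * pi"
  shows "cmod (U (rcis r \<theta>)) \<le> 6 powr c * A ((1 - r) + min \<theta> (2 * pi - \<theta>))"
proof -
  define v where "v = (1 - r) + min \<theta> (2 * pi - \<theta>)"
  have v: "v > 0" using r \<theta> by (simp add: v_def add_pos_nonneg)
  have "ennreal (cmod (U (rcis r \<theta>))) \<le> (\<integral>\<^sup>+s. ennreal (g s * cmod (1 - of_real (1 - s) * rcis r \<theta>) powr - c) \<partial>lborel)"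
    by (rule U_le) (use r in simp)
  also have "\<dots> \<le> (\<integral>\<^sup>+s. ennreal (6 powr c) * (ennreal (g s * (s + v) powr - c) * indicator {0<..} s) \<partial>lborel)"
  proof (rule nn_integral_mono)
    fix s :: real
    show "ennreal (g s * cmod (1 - of_real (1 - s) * rcis r \<theta>) powr - c)
      \<le> ennreal (6 powr c) * (ennreal (g s * (s + v) powr - c) * indicator {0<..} s)"
    proof (cases "s \<in> {0<..<1}")
      case True
      have "s + v \<le> 6 * cmod (1 - of_real (1 - s) * rcis r \<theta>)"
        using hilbert_kernel_lower_bound[of "1 - s" r \<theta>] True r \<theta> by (simp add: v_def del: of_real_diff)
      then have "(s + v) / 6 \<le> cmod (1 - of_real (1 - s) * rcis r \<theta>)" by simp
      then have "cmod (1 - of_real (1 - s) * rcis r \<theta>) powr - c \<le> ((s + v) / 6) powr - c"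
        using True v c_pos by (intro powr_mono2') auto
      also have "\<dots> = 6 powr c * (s + v) powr - c"
        using True v by (simp add: powr_divide powr_minus divide_simps)
      finally have "g s * cmod (1 - of_real (1 - s) * rcis r \<theta>) powr - c \<le> g s * (6 powr c * (s + v) powr - c)"
        by (intro mult_left_mono g_nonneg)
      then have "ennreal (g s * cmod (1 - of_real (1 - s) * rcis r \<theta>) powr - c) \<le> ennreal (6 powr c * (g s * (s + v) powr - c))"
        by (intro ennreal_leI) (simp add: mult.left_commute)
      also have "\<dots> = ennreal (6 powr c) * ennreal (g s * (s + v) powr - c)"
        using g_nonneg[of s] by (intro ennreal_mult) auto
      finally show ?thesis using True by simp
    qed (use g_supp in simp)
  qed
  also have "\<dots> = ennreal (6 powr c) * (\<integral>\<^sup>+s\<in>{0<..}. ennreal (g s * (s + v) powr - c) \<partial>lborel)"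
    by (rule nn_integral_cmult) measurable
  also have "\<dots> = ennreal (6 powr c) * ennreal (A v)"
    using ennreal_stieltjes_transform[OF g_meas g_nonneg g_fin, of c v] c_pos v by simp
  also have "\<dots> = ennreal (6 powr c * A v)" by (rule ennreal_mult[symmetric]) (auto simp: A_nonneg)
  finally show ?thesis unfolding v_def by (simp add: A_nonneg)
qed

text \<open>The 2 counts the two halves of the circle, each bounded by one tail of \<open>A\<close>.
  The lower limit 1 - r is retained because it becomes an integration variable in the area
  estimate.\<close>

lemma circle_bound:
  assumes r: "0 \<le> r" "r < 1" and p: "p > 0"
  shows "(\<integral>\<^sup>+\<theta>\<in>{0..2*pi}. ennreal (cmod (U (rcis r \<theta>)) powr p) \<partial>lborel)
    \<le> ennreal (2 * 6 powr (c * p)) * (\<integral>\<^sup>+v\<in>{1 - r<..}. ennreal (A v powr p) \<partial>lborel)"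
proof -
  \<comment> \<open>Extending each half circle to the whole half line only enlarges the bound and
    turns it into a tail integral.\<close>
  define B where "B \<theta> = ennreal (A (1 - r + \<theta>) powr p) * indicator {0..} \<theta>" for \<theta>
  have [measurable]: "B \<in> borel_measurable borel" unfolding B_def by measurable
  have "(\<integral>\<^sup>+\<theta>\<in>{0..2*pi}. ennreal (cmod (U (rcis r \<theta>)) powr p) \<partial>lborel)
    \<le> (\<integral>\<^sup>+\<theta>. ennreal (6 powr (c * p)) * (B \<theta> + B (2 * pi - \<theta>)) \<partial>lborel)"
  proof (rule nn_integral_mono)
    fix \<theta> :: real
    show "ennreal (cmod (U (rcis r \<theta>)) powr p) * indicator {0..2*pi} \<theta> \<le> ennreal (6 powr (c * p)) * (B \<theta> + B (2 * pi - \<theta>))"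
    proof (cases "\<theta> \<in> {0..2*pi}")
      case True
      define m where "m = min \<theta> (2 * pi - \<theta>)"
      have "cmod (U (rcis r \<theta>)) powr p \<le> (6 powr c * A (1 - r + m)) powr p"
        unfolding m_def using True p r by (intro powr_mono2 pointwise_bound) auto
      also have "\<dots> = 6 powr (c * p) * A (1 - r + m) powr p"
        using A_nonneg by (simp add: powr_mult powr_powr)
      finally have "ennreal (cmod (U (rcis r \<theta>)) powr p) \<le> ennreal (6 powr (c * p) * A (1 - r + m) powr p)"
        by (rule ennreal_leI)
      also have "\<dots> = ennreal (6 powr (c * p)) * ennreal (A (1 - r + m) powr p)"
        by (rule ennreal_mult) auto
      also have "ennreal (A (1 - r + m) powr p) \<le> B \<theta> + B (2 * pi - \<theta>)"
        using True by (cases "\<theta> \<le> 2 * pi - \<theta>") (auto simp: B_def m_def min_def)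
      finally show ?thesis using True by (simp add: mult_left_mono)
    qed simp
  qed
  also have "\<dots> = ennreal (6 powr (c * p)) * ((\<integral>\<^sup>+\<theta>. B \<theta> \<partial>lborel) + (\<integral>\<^sup>+\<theta>. B (2 * pi - \<theta>) \<partial>lborel))"
    by (subst nn_integral_cmult, measurable, subst nn_integral_add) auto
  also have "(\<integral>\<^sup>+\<theta>. B (2 * pi - \<theta>) \<partial>lborel) = (\<integral>\<^sup>+\<theta>. B \<theta> \<partial>lborel)"
    by (rule nn_integral_reflect) measurable
  also have "(\<integral>\<^sup>+\<theta>. B \<theta> \<partial>lborel) = (\<integral>\<^sup>+v\<in>{1 - r<..}. ennreal (A v powr p) \<partial>lborel)"
  proof -
    have "(\<integral>\<^sup>+\<theta>. B \<theta> \<partial>lborel) = (\<integral>\<^sup>+\<theta>. ennreal (A (1 - r + 1 * \<theta>) powr p) * indicator {1 - r<..} (1 - r + 1 * \<theta>) \<partial>lborel)"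
      by (rule nn_integral_cong_AE, rule eventually_mono[OF AE_lborel_singleton[of 0]])
         (auto simp: B_def indicator_def)
    also have "\<dots> = (\<integral>\<^sup>+v\<in>{1 - r<..}. ennreal (A v powr p) \<partial>lborel)"
      using nn_integral_real_affine[of "\<lambda>v. ennreal (A v powr p) * indicator {1 - r<..} v" 1 "1 - r"] by simp
    finally show ?thesis .
  qed
  also have "ennreal (6 powr (c * p)) * ((\<integral>\<^sup>+v\<in>{1 - r<..}. ennreal (A v powr p) \<partial>lborel) + (\<integral>\<^sup>+v\<in>{1 - r<..}. ennreal (A v powr p) \<partial>lborel))
    = ennreal (2 * 6 powr (c * p)) * (\<integral>\<^sup>+v\<in>{1 - r<..}. ennreal (A v powr p) \<partial>lborel)"
  proof -
    have "ennreal (2 * 6 powr (c * p)) = 2 * ennreal (6 powr (c * p))" by (subst ennreal_mult) auto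
    then show ?thesis by (simp only: mult_2[symmetric] mult.assoc mult.left_commute)
  qed
  finally show ?thesis .
qed

lemma bergman_bound_stieltjes:
  assumes U: "U holomorphic_on ball 0 1" and p: "p > 0" and \<alpha>: "\<alpha> > -1"
  shows "bergman_nn_integral p \<alpha> U \<le> ennreal (2 powr \<bar>\<alpha>\<bar> * (2 * 6 powr (c * p)) / (\<alpha> + 1)) *
    (\<integral>\<^sup>+v\<in>{0<..}. ennreal (A v powr p * v powr (\<alpha> + 1)) \<partial>lborel)"
proof -
  let ?k = "2 powr \<bar>\<alpha>\<bar> * (2 * 6 powr (c * p))"
  let ?J = "\<lambda>d v. ennreal (d powr \<alpha>) * (ennreal (A v powr p) * indicator {d<..} v) * indicator {0<..} d"
  have [measurable]: "(\<lambda>(d, v). ?J d v) \<in> borel_measurable (borel \<Otimes>\<^sub>M borel)"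
    by (simp add: indicator_def case_prod_unfold)
  have "bergman_nn_integral p \<alpha> U \<le> (\<integral>\<^sup>+r. ennreal ?k * (\<integral>\<^sup>+v. ?J (1 - r) v \<partial>lborel) \<partial>lborel)"
    unfolding bergman_nn_integral_polar[OF U p]
  proof (rule nn_integral_mono)
    fix r :: real
    show "ennreal (r * (1 - r\<^sup>2) powr \<alpha>) * (\<integral>\<^sup>+\<theta>\<in>{0..2*pi}. ennreal (cmod (U (rcis r \<theta>)) powr p) \<partial>lborel) * indicator {0<..<1} r
      \<le> ennreal ?k * (\<integral>\<^sup>+v. ?J (1 - r) v \<partial>lborel)"
    proof (cases "0 < r \<and> r < 1")
      case True
      have "r * (1 - r\<^sup>2) powr \<alpha> \<le> 1 * (1 - r\<^sup>2) powr \<alpha>" using True by (intro mult_right_mono) auto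
      also have "\<dots> \<le> 2 powr \<bar>\<alpha>\<bar> * (1 - r) powr \<alpha>"
        using one_minus_power2_powr_bounds(2)[of r \<alpha>] True by simp
      finally have le: "r * (1 - r\<^sup>2) powr \<alpha> \<le> 2 powr \<bar>\<alpha>\<bar> * (1 - r) powr \<alpha>" .
      have "ennreal (r * (1 - r\<^sup>2) powr \<alpha>) * (\<integral>\<^sup>+\<theta>\<in>{0..2*pi}. ennreal (cmod (U (rcis r \<theta>)) powr p) \<partial>lborel)
        \<le> ennreal (2 powr \<bar>\<alpha>\<bar> * (1 - r) powr \<alpha>) * (ennreal (2 * 6 powr (c * p)) * (\<integral>\<^sup>+v\<in>{1 - r<..}. ennreal (A v powr p) \<partial>lborel))"
        using True p by (intro mult_mono ennreal_leI[OF le] circle_bound) auto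
      also have "\<dots> = ennreal ?k * (\<integral>\<^sup>+v. ?J (1 - r) v \<partial>lborel)"
      proof -
        have "(\<integral>\<^sup>+v. ?J (1 - r) v \<partial>lborel) = (\<integral>\<^sup>+v. ennreal ((1 - r) powr \<alpha>) * (ennreal (A v powr p) * indicator {1 - r<..} v) \<partial>lborel)"
          using True by simp
        also have "\<dots> = ennreal ((1 - r) powr \<alpha>) * (\<integral>\<^sup>+v\<in>{1 - r<..}. ennreal (A v powr p) \<partial>lborel)"
          by (rule nn_integral_cmult) measurable
        finally have e1: "(\<integral>\<^sup>+v. ?J (1 - r) v \<partial>lborel)
          = ennreal ((1 - r) powr \<alpha>) * (\<integral>\<^sup>+v\<in>{1 - r<..}. ennreal (A v powr p) \<partial>lborel)" .
        have e2: "ennreal (2 powr \<bar>\<alpha>\<bar> * (1 - r) powr \<alpha>) = ennreal (2 powr \<bar>\<alpha>\<bar>) * ennreal ((1 - r) powr \<alpha>)"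
          by (rule ennreal_mult) auto
        have e3: "ennreal ?k = ennreal (2 powr \<bar>\<alpha>\<bar>) * ennreal (2 * 6 powr (c * p))"
          by (rule ennreal_mult) auto
        show ?thesis unfolding e1 e2 e3 by (simp only: mult.assoc mult.left_commute)
      qed
      finally show ?thesis using True by simp
    qed auto
  qed
  also have "\<dots> = ennreal ?k * (\<integral>\<^sup>+r. (\<integral>\<^sup>+v. ?J (1 - r) v \<partial>lborel) \<partial>lborel)"
    by (rule nn_integral_cmult) measurable
  finally have le: "bergman_nn_integral p \<alpha> U \<le> ennreal ?k * (\<integral>\<^sup>+r. (\<integral>\<^sup>+v. ?J (1 - r) v \<partial>lborel) \<partial>lborel)" .
  have "(\<integral>\<^sup>+r. (\<integral>\<^sup>+v. ?J (1 - r) v \<partial>lborel) \<partial>lborel) = (\<integral>\<^sup>+d. (\<integral>\<^sup>+v. ?J d v \<partial>lborel) \<partial>lborel)"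
    by (rule nn_integral_reflect) measurable
  \<comment> \<open>For fixed v the remaining range is 0 < d < v, so integrating
    \<open>d powr \<alpha>\<close> there raises the exponent by one and produces the division by
    \<alpha> + 1.\<close>
  also have "\<dots> = (\<integral>\<^sup>+v. (\<integral>\<^sup>+d. ?J d v \<partial>lborel) \<partial>lborel)"
    by (rule lborel_pair.Fubini') measurable
  also have "\<dots> = (\<integral>\<^sup>+v. ennreal (1 / (\<alpha> + 1)) * (ennreal (A v powr p * v powr (\<alpha> + 1)) * indicator {0<..} v) \<partial>lborel)"
  proof (rule nn_integral_cong)
    fix v :: real
    show "(\<integral>\<^sup>+d. ?J d v \<partial>lborel) = ennreal (1 / (\<alpha> + 1)) * (ennreal (A v powr p * v powr (\<alpha> + 1)) * indicator {0<..} v)"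
    proof (cases "v > 0")
      case True
      have "(\<integral>\<^sup>+d. ?J d v \<partial>lborel) = (\<integral>\<^sup>+d. ennreal (A v powr p) * (ennreal (d powr \<alpha>) * indicator {0<..<v} d) \<partial>lborel)"
        by (intro nn_integral_cong) (auto simp: indicator_def mult.commute)
      also have "\<dots> = ennreal (A v powr p) * ennreal (v powr (\<alpha> + 1) / (\<alpha> + 1))"
        using nn_integral_powr_Ioo[OF True \<alpha>] by (simp add: nn_integral_cmult)
      finally show ?thesis using True \<alpha> by (simp add: ennreal_mult[symmetric])
    next
      case False
      then have "?J d v = 0" for d by (auto simp: indicator_def)
      then have "(\<integral>\<^sup>+d. ?J d v \<partial>lborel) = 0" by (simp only: nn_integral_const mult_zero_left)
      then show ?thesis using False by simp
    qed
  qed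
  also have "\<dots> = ennreal (1 / (\<alpha> + 1)) * (\<integral>\<^sup>+v\<in>{0<..}. ennreal (A v powr p * v powr (\<alpha> + 1)) \<partial>lborel)"
    by (rule nn_integral_cmult) measurable
  finally have eq: "(\<integral>\<^sup>+r. (\<integral>\<^sup>+v. ?J (1 - r) v \<partial>lborel) \<partial>lborel)
    = ennreal (1 / (\<alpha> + 1)) * (\<integral>\<^sup>+v\<in>{0<..}. ennreal (A v powr p * v powr (\<alpha> + 1)) \<partial>lborel)" .
  have "ennreal (?k / (\<alpha> + 1)) = ennreal (?k * (1 / (\<alpha> + 1)))" by simp
  also have "\<dots> = ennreal ?k * ennreal (1 / (\<alpha> + 1))" by (rule ennreal_mult) (use \<alpha> in auto)
  finally show ?thesis using le unfolding eq by (simp only: mult.assoc)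
qed

end

section \<open>Circle and area estimates with constants independent of g and U\<close>

lemma cauchy_type_hardy_bound:
  fixes p :: real
  assumes p: "p > 1"
  shows "\<exists>C>0. \<forall>g U r. cauchy_type_bound g 1 U \<longrightarrow> 0 \<le> r \<longrightarrow> r < 1 \<longrightarrow>
    (\<integral>\<^sup>+\<theta>\<in>{0..2*pi}. ennreal (cmod (U (rcis r \<theta>)) powr p) \<partial>lborel)
      \<le> ennreal C * (\<integral>\<^sup>+s\<in>{0<..}. ennreal (g s powr p * s powr 0) \<partial>lborel)"
proof -
  obtain C where C: "C > 0" and hilb: "\<And>h A. h \<in> borel_measurable borel \<Longrightarrow> (\<And>s. 0 \<le> h s) \<Longrightarrow> (\<And>v. v > 0 \<Longrightarrow> 0 \<le> A v) \<Longrightarrow>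
    (\<And>v. v > 0 \<Longrightarrow> ennreal (A v) \<le> (\<integral>\<^sup>+s\<in>{0<..}. ennreal (h s * (s + v) powr - 1) \<partial>lborel)) \<Longrightarrow>
    (\<integral>\<^sup>+v\<in>{0<..}. ennreal (A v powr p * v powr 0) \<partial>lborel)
      \<le> ennreal C * (\<integral>\<^sup>+s\<in>{0<..}. ennreal (h s powr p * s powr (0 + p * (1 - 1))) \<partial>lborel)"
    using weighted_hilbert_inequality[of p 0 1] p by auto
  define K where "K = 2 * 6 powr (1 * p)"
  have K: "K > 0" by (simp add: K_def)
  show ?thesis
  proof (intro exI[of _ "K * C"] conjI allI impI)
    show "K * C > 0" using K C by simp
    fix g U and r :: real
    assume cb: "cauchy_type_bound g 1 U" and r: "0 \<le> r" "r < 1"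
    interpret cauchy_type_bound g 1 U by (rule cb)
    have "(\<integral>\<^sup>+\<theta>\<in>{0..2*pi}. ennreal (cmod (U (rcis r \<theta>)) powr p) \<partial>lborel)
      \<le> ennreal K * (\<integral>\<^sup>+v\<in>{1 - r<..}. ennreal (A v powr p) \<partial>lborel)"
      unfolding K_def using p by (intro circle_bound r) simp
    also have "\<dots> \<le> ennreal K * (\<integral>\<^sup>+v\<in>{0<..}. ennreal (A v powr p * v powr 0) \<partial>lborel)"
      using r by (intro mult_left_mono nn_integral_mono) (auto simp: indicator_def)
    also have "\<dots> \<le> ennreal K * (ennreal C * (\<integral>\<^sup>+s\<in>{0<..}. ennreal (g s powr p * s powr (0 + p * (1 - 1))) \<partial>lborel))"
      by (intro mult_left_mono hilb g_meas g_nonneg A_nonneg ennreal_stieltjes_transform_le) auto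
    also have "\<dots> = ennreal (K * C) * (\<integral>\<^sup>+s\<in>{0<..}. ennreal (g s powr p * s powr (0 + p * (1 - 1))) \<partial>lborel)"
      using K C by (subst ennreal_mult[of K C]) (auto simp: mult.assoc)
    finally show "(\<integral>\<^sup>+\<theta>\<in>{0..2*pi}. ennreal (cmod (U (rcis r \<theta>)) powr p) \<partial>lborel)
      \<le> ennreal (K * C) * (\<integral>\<^sup>+s\<in>{0<..}. ennreal (g s powr p * s powr 0) \<partial>lborel)"
      by (simp only: diff_self mult_zero_right add_0_left)
  qed
qed

text \<open>The condition on \<alpha> is that of the weighted inequality at g = \<alpha> + 1.
  Raising c by one lowers the exponent on the radius by p, which offsets the p that Hardy's
  inequality adds.\<close>

lemma cauchy_type_bergman_bound:
  fixes p \<alpha> c :: real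
  assumes p: "p > 1" and \<alpha>: "\<alpha> > -1" "\<alpha> + 2 < c * p"
  shows "\<exists>C>0. \<forall>g U. cauchy_type_bound g c U \<longrightarrow> U holomorphic_on ball 0 1 \<longrightarrow>
    bergman_nn_integral p \<alpha> U \<le> ennreal C * (\<integral>\<^sup>+s\<in>{0<..}. ennreal (g s powr p * s powr (\<alpha> + 1 + p * (1 - c))) \<partial>lborel)"
proof -
  obtain C where C: "C > 0" and hilb: "\<And>h A. h \<in> borel_measurable borel \<Longrightarrow> (\<And>s. 0 \<le> h s) \<Longrightarrow> (\<And>v. v > 0 \<Longrightarrow> 0 \<le> A v) \<Longrightarrow>
    (\<And>v. v > 0 \<Longrightarrow> ennreal (A v) \<le> (\<integral>\<^sup>+s\<in>{0<..}. ennreal (h s * (s + v) powr - c) \<partial>lborel)) \<Longrightarrow>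
    (\<integral>\<^sup>+v\<in>{0<..}. ennreal (A v powr p * v powr (\<alpha> + 1)) \<partial>lborel)
      \<le> ennreal C * (\<integral>\<^sup>+s\<in>{0<..}. ennreal (h s powr p * s powr (\<alpha> + 1 + p * (1 - c))) \<partial>lborel)"
    using weighted_hilbert_inequality[of p "\<alpha> + 1" c] p \<alpha> by auto
  define K where "K = 2 powr \<bar>\<alpha>\<bar> * (2 * 6 powr (c * p)) / (\<alpha> + 1)"
  have K: "K > 0" using \<alpha> by (simp add: K_def)
  show ?thesis
  proof (intro exI[of _ "K * C"] conjI allI impI)
    show "K * C > 0" using K C by simp
    fix g U
    assume cb: "cauchy_type_bound g c U" and U: "U holomorphic_on ball 0 1"
    interpret cauchy_type_bound g c U by (rule cb)
    have "bergman_nn_integral p \<alpha> U \<le> ennreal K * (\<integral>\<^sup>+v\<in>{0<..}. ennreal (A v powr p * v powr (\<alpha> + 1)) \<partial>lborel)"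
      unfolding K_def using p \<alpha> by (intro bergman_bound_stieltjes U) auto
    also have "\<dots> \<le> ennreal K * (ennreal C * (\<integral>\<^sup>+s\<in>{0<..}. ennreal (g s powr p * s powr (\<alpha> + 1 + p * (1 - c))) \<partial>lborel))"
      by (intro mult_left_mono hilb g_meas g_nonneg A_nonneg ennreal_stieltjes_transform_le) auto
    also have "\<dots> = ennreal (K * C) * (\<integral>\<^sup>+s\<in>{0<..}. ennreal (g s powr p * s powr (\<alpha> + 1 + p * (1 - c))) \<partial>lborel)"
      using K C by (subst ennreal_mult[of K C]) (auto simp: mult.assoc)
    finally show "bergman_nn_integral p \<alpha> U \<le> ennreal (K * C) * (\<integral>\<^sup>+s\<in>{0<..}. ennreal (g s powr p * s powr (\<alpha> + 1 + p * (1 - c))) \<partial>lborel)" .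
  qed
qed

section \<open>The sublinear Hilbert operator\<close>

lemma cauchy_kernel_norm_ge:
  fixes z :: complex
  assumes "cmod z \<le> R" "0 \<le> t" "t \<le> 1"
  shows "1 - R \<le> cmod (1 - of_real t * z)"
proof -
  have "cmod (of_real t * z) \<le> 1 * R"
    unfolding norm_mult using assms by (intro mult_mono) auto
  then show ?thesis using norm_triangle_ineq2[of 1 "of_real t * z"] by simp
qed

lemma cauchy_type_integrable:
  fixes \<rho> :: "real \<Rightarrow> real" and z :: complex
  assumes \<rho>: "integrable lborel \<rho>" and supp: "\<And>s. s \<notin> {0<..<1} \<Longrightarrow> \<rho> s = 0" and z: "cmod z < 1"
  shows "integrable lborel (\<lambda>s. of_real (\<rho> s) / (1 - of_real (1 - s) * z))"
proof (rule Bochner_Integration.integrable_bound)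
  show "integrable lborel (\<lambda>s. \<rho> s / (1 - cmod z))" using \<rho> by simp
  have [measurable]: "\<rho> \<in> borel_measurable borel" using \<rho> by simp
  show "(\<lambda>s. of_real (\<rho> s) / (1 - of_real (1 - s) * z)) \<in> borel_measurable lborel" by measurable
  show "AE s in lborel. norm (of_real (\<rho> s) / (1 - of_real (1 - s) * z)) \<le> norm (\<rho> s / (1 - cmod z))"
  proof (rule AE_I2)
    fix s
    show "norm (of_real (\<rho> s) / (1 - of_real (1 - s) * z)) \<le> norm (\<rho> s / (1 - cmod z))"
    proof (cases "s \<in> {0<..<1}")
      case True
      then show ?thesis
        using cauchy_kernel_norm_ge[of z "cmod z" "1 - s"] z
        by (simp add: norm_divide frac_le del: of_real_diff)
    qed (simp add: supp)
  qed
qed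

text \<open>Differentiation under the integral sign. The difference quotient of 1 / (1 - t z)
  between y and z is t / ((1 - t y) (1 - t z)), so dominated convergence along sequences is
  enough.\<close>

lemma cauchy_type_has_field_derivative:
  fixes \<rho> :: "real \<Rightarrow> real" and z :: complex
  assumes \<rho>: "integrable lborel \<rho>" and supp: "\<And>s. s \<notin> {0<..<1} \<Longrightarrow> \<rho> s = 0" and z: "cmod z < 1"
  shows "((\<lambda>z. \<integral>s. of_real (\<rho> s) / (1 - of_real (1 - s) * z) \<partial>lborel) has_field_derivative
     (\<integral>s. of_real (\<rho> s * (1 - s)) / (1 - of_real (1 - s) * z)\<^sup>2 \<partial>lborel)) (at z)"
proof -
  define G where "G z = (\<integral>s. of_real (\<rho> s) / (1 - of_real (1 - s) * z) \<partial>lborel)" for z :: complex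
  define D where "D = (\<integral>s. of_real (\<rho> s * (1 - s)) / (1 - of_real (1 - s) * z)\<^sup>2 \<partial>lborel)"
  \<comment> \<open>Halfway to the boundary: on the disc of radius R both kernel factors are at
    least 1 - R, which gives one dominating function for the whole sequence.\<close>
  define R where "R = (1 + cmod z) / 2"
  have R: "cmod z < R" "R < 1" using z by (auto simp: R_def)
  have [measurable]: "\<rho> \<in> borel_measurable borel" using \<rho> by simp
  have "((\<lambda>y. (G y - G z) / (y - z)) \<longlongrightarrow> D) (at z within ball 0 R)"
    unfolding tendsto_at_iff_sequentially
  proof (intro allI impI)
    fix X :: "nat \<Rightarrow> complex"
    assume X: "\<forall>i. X i \<in> ball 0 R - {z}" and lim: "X \<longlonglongrightarrow> z"
    let ?k = "\<lambda>y s. of_real (\<rho> s * (1 - s)) / ((1 - of_real (1 - s) * y) * (1 - of_real (1 - s) * z)) :: complex"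
    have quot: "((\<lambda>y. (G y - G z) / (y - z)) \<circ> X) i = (\<integral>s. ?k (X i) s \<partial>lborel)" for i
    proof -
      have Xi: "cmod (X i) < 1" "X i \<noteq> z" using X[rule_format, of i] R by auto
      have "G (X i) - G z = (\<integral>s. of_real (\<rho> s) / (1 - of_real (1 - s) * X i) - of_real (\<rho> s) / (1 - of_real (1 - s) * z) \<partial>lborel)"
        unfolding G_def
        by (rule Bochner_Integration.integral_diff[symmetric]; rule cauchy_type_integrable[OF \<rho> supp]) (use Xi z in auto)
      also have "\<dots> = (\<integral>s. ?k (X i) s * (X i - z) \<partial>lborel)"
      proof (rule Bochner_Integration.integral_cong[OF refl])
        fix s
        show "of_real (\<rho> s) / (1 - of_real (1 - s) * X i) - of_real (\<rho> s) / (1 - of_real (1 - s) * z) = ?k (X i) s * (X i - z)"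
        proof (cases "s \<in> {0<..<1}")
          case True
          define t where "t = complex_of_real (1 - s)"
          have "1 - t * X i \<noteq> 0" "1 - t * z \<noteq> 0"
            using cauchy_kernel_norm_ge[of "X i" "cmod (X i)" "1 - s"] cauchy_kernel_norm_ge[of z "cmod z" "1 - s"] True Xi z
            by (auto simp: t_def simp del: of_real_diff)
          then have "of_real (\<rho> s) / (1 - t * X i) - of_real (\<rho> s) / (1 - t * z)
            = of_real (\<rho> s) * t / ((1 - t * X i) * (1 - t * z)) * (X i - z)"
            by (simp add: divide_simps) (simp add: algebra_simps)
          then show ?thesis unfolding t_def by (simp only: of_real_mult)
        qed (simp add: supp)
      qed
      also have "\<dots> = (\<integral>s. ?k (X i) s \<partial>lborel) * (X i - z)" by (rule integral_mult_left_zero)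
      finally show ?thesis using Xi by simp
    qed
    have "(\<lambda>i. \<integral>s. ?k (X i) s \<partial>lborel) \<longlonglongrightarrow> (\<integral>s. ?k z s \<partial>lborel)"
    proof (rule integral_dominated_convergence[where w = "\<lambda>s. \<bar>\<rho> s\<bar> / ((1 - R) * (1 - R))"])
      show "integrable lborel (\<lambda>s. \<bar>\<rho> s\<bar> / ((1 - R) * (1 - R)))" using \<rho> by simp
      show "AE s in lborel. (\<lambda>i. ?k (X i) s) \<longlonglongrightarrow> ?k z s"
      proof (rule AE_I2)
        fix s
        show "(\<lambda>i. ?k (X i) s) \<longlonglongrightarrow> ?k z s"
        proof (cases "s \<in> {0<..<1}")
          case True
          then have "1 - of_real (1 - s) * z \<noteq> 0"
            using cauchy_kernel_norm_ge[of z "cmod z" "1 - s"] z by (auto simp del: of_real_diff)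
          then show ?thesis by (intro tendsto_intros lim) auto
        qed (simp add: supp)
      qed
      show "AE s in lborel. norm (?k (X i) s) \<le> \<bar>\<rho> s\<bar> / ((1 - R) * (1 - R))" for i
      proof (rule AE_I2)
        fix s
        show "norm (?k (X i) s) \<le> \<bar>\<rho> s\<bar> / ((1 - R) * (1 - R))"
        proof (cases "s \<in> {0<..<1}")
          case True
          have "1 - R \<le> cmod (1 - of_real (1 - s) * X i)" "1 - R \<le> cmod (1 - of_real (1 - s) * z)"
            using X[rule_format, of i] True R by (intro cauchy_kernel_norm_ge; simp)+
          then show ?thesis
            unfolding norm_divide norm_mult norm_of_real abs_mult
            using True R by (intro frac_le mult_mono) (auto simp: mult_left_le simp del: of_real_diff)
        qed (simp add: supp)
      qed
    qed measurable
    then show "((\<lambda>y. (G y - G z) / (y - z)) \<circ> X) \<longlonglongrightarrow> D"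
      unfolding D_def by (simp only: quot comp_def power2_eq_square) (simp add: quot[unfolded comp_def])
  qed
  moreover have "at z within ball 0 R = at z" using R by (intro at_within_open) auto
  ultimately have "(G has_field_derivative D) (at z)" by (simp add: has_field_derivative_iff)
  then show ?thesis unfolding G_def D_def .
qed

lemma radial_modulus_supp: "s \<notin> {0<..<1} \<Longrightarrow> radial_modulus f s = 0"
  by (simp add: radial_modulus_def)

section \<open>The operator on functions integrable along the radius\<close>

context
  fixes f :: "complex \<Rightarrow> complex"
  assumes f: "f holomorphic_on ball 0 1"
    and fin: "(\<integral>\<^sup>+s. ennreal (radial_modulus f s) \<partial>lborel) < \<infinity>"
begin

lemma radial_modulus_integrable: "integrable lborel (radial_modulus f)"
  using fin radial_modulus_measurable[OF f] radial_modulus_nonneg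
  by (intro integrableI_nonneg) auto

text \<open>The substitution s = 1 - t. The integrands can differ at t = 0, which the operator
  includes and \<open>radial_modulus\<close> leaves out.\<close>

lemma sublinear_hilbert_eq:
  assumes z: "cmod z < 1"
  shows "sublinear_hilbert f z = (\<integral>s. of_real (radial_modulus f s) / (1 - of_real (1 - s) * z) \<partial>lborel)"
proof -
  have [measurable]: "radial_modulus f \<in> borel_measurable borel" by (rule radial_modulus_measurable[OF f])
  have ne: "1 - of_real t * z \<noteq> 0" if "t \<in> {0..<1}" for t
    using cauchy_kernel_norm_ge[of z "cmod z" t] z that by auto
  have m: "(\<lambda>t. indicator {0..<1} t *\<^sub>R (complex_of_real (cmod (f (complex_of_real t))) / (1 - complex_of_real t * z))) \<in> borel_measurable borel"
    by (intro borel_measurable_continuous_on_indicator continuous_intros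
          continuous_on_compose2[OF holomorphic_on_imp_continuous_on[OF f]]) (use ne in auto)
  have "sublinear_hilbert f z = (\<integral>t. of_real (radial_modulus f (1 - t)) / (1 - of_real t * z) \<partial>lborel)"
    unfolding sublinear_hilbert_def set_lebesgue_integral_def
  proof (rule integral_cong_AE)
    show "AE t in lborel. indicator {0..<1} t *\<^sub>R (complex_of_real (cmod (f (complex_of_real t))) / (1 - complex_of_real t * z))
      = of_real (radial_modulus f (1 - t)) / (1 - of_real t * z)"
      by (rule eventually_mono[OF AE_lborel_singleton[of 0]]) (auto simp: radial_modulus_def indicator_def)
  qed (use m in \<open>simp_all, measurable\<close>)
  also have "\<dots> = (\<integral>s. of_real (radial_modulus f s) / (1 - of_real (1 - s) * z) \<partial>lborel)"
    using lborel_integral_real_affine[of "-1" "\<lambda>t. of_real (radial_modulus f (1 - t)) / (1 - of_real t * z)" 1]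
    by simp
  finally show ?thesis .
qed

lemma sublinear_hilbert_has_field_derivative:
  assumes z: "cmod z < 1"
  shows "(sublinear_hilbert f has_field_derivative
     (\<integral>s. of_real (radial_modulus f s * (1 - s)) / (1 - of_real (1 - s) * z)\<^sup>2 \<partial>lborel)) (at z)"
proof (rule has_field_derivative_transform_within_open[OF _ open_ball[of 0 1]])
  show "((\<lambda>z. \<integral>s. of_real (radial_modulus f s) / (1 - of_real (1 - s) * z) \<partial>lborel) has_field_derivative
     (\<integral>s. of_real (radial_modulus f s * (1 - s)) / (1 - of_real (1 - s) * z)\<^sup>2 \<partial>lborel)) (at z)"
    by (rule cauchy_type_has_field_derivative[OF radial_modulus_integrable radial_modulus_supp z])
qed (use z sublinear_hilbert_eq in auto)

lemma sublinear_hilbert_holomorphic: "sublinear_hilbert f holomorphic_on ball 0 1"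
  unfolding holomorphic_on_open[OF open_ball]
  by (intro ballI exI, rule sublinear_hilbert_has_field_derivative) simp

lemma sublinear_hilbert_bound: "cauchy_type_bound (radial_modulus f) 1 (sublinear_hilbert f)"
proof
  fix z :: complex assume "z \<in> ball 0 1"
  then have z: "cmod z < 1" by simp
  have "ennreal (cmod (sublinear_hilbert f z)) \<le> (\<integral>\<^sup>+s. ennreal (cmod (of_real (radial_modulus f s) / (1 - of_real (1 - s) * z))) \<partial>lborel)"
    unfolding sublinear_hilbert_eq[OF z]
    by (intro integral_norm_bound_ennreal cauchy_type_integrable radial_modulus_integrable radial_modulus_supp z)
  also have "\<dots> = (\<integral>\<^sup>+s. ennreal (radial_modulus f s * cmod (1 - of_real (1 - s) * z) powr - 1) \<partial>lborel)"
    by (intro nn_integral_cong) (simp add: norm_divide norm_mult norm_inverse powr_minus divide_inverse radial_modulus_nonneg)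
  finally show "ennreal (cmod (sublinear_hilbert f z)) \<le> (\<integral>\<^sup>+s. ennreal (radial_modulus f s * cmod (1 - of_real (1 - s) * z) powr - 1) \<partial>lborel)" .
qed (use f fin radial_modulus_measurable radial_modulus_nonneg radial_modulus_supp in auto)

text \<open>Differentiating the kernel squares the denominator and brings down t = 1 - s, which is
  at most 1 on the support.\<close>

lemma deriv_sublinear_hilbert_bound: "cauchy_type_bound (radial_modulus f) 2 (deriv (sublinear_hilbert f))"
proof
  fix z :: complex assume "z \<in> ball 0 1"
  then have z: "cmod z < 1" by simp
  let ?h = "\<lambda>s. complex_of_real (radial_modulus f s * (1 - s)) / (1 - of_real (1 - s) * z)\<^sup>2"
  have "ennreal (cmod (\<integral>s. ?h s \<partial>lborel)) \<le> (\<integral>\<^sup>+s. ennreal (cmod (?h s)) \<partial>lborel)"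
    \<comment> \<open>Without integrability the Bochner integral is 0 by convention and the bound is
      trivial.\<close>
    by (cases "integrable lborel ?h") (auto simp: integral_norm_bound_ennreal not_integrable_integral_eq)
  also have "\<dots> \<le> (\<integral>\<^sup>+s. ennreal (radial_modulus f s * cmod (1 - of_real (1 - s) * z) powr - 2) \<partial>lborel)"
  proof (intro nn_integral_mono ennreal_leI)
    fix s :: real
    show "cmod (?h s) \<le> radial_modulus f s * cmod (1 - of_real (1 - s) * z) powr - 2"
    proof (cases "s \<in> {0<..<1}")
      case True
      define k where "k = cmod (1 - of_real (1 - s) * z)"
      have "1 - cmod z \<le> k"
        unfolding k_def by (rule cauchy_kernel_norm_ge) (use True in auto)
      then have "k > 0" using z by linarith
      then have k: "k powr - 2 = 1 / k\<^sup>2" by (simp add: powr_minus divide_inverse)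
      have "cmod (?h s) = radial_modulus f s * (1 - s) * (1 / k\<^sup>2)"
        unfolding norm_divide norm_power norm_of_real k_def[symmetric]
        using True radial_modulus_nonneg[of f s] by (simp add: abs_mult)
      also have "\<dots> \<le> radial_modulus f s * 1 * (1 / k\<^sup>2)"
        using True radial_modulus_nonneg[of f s] by (intro mult_right_mono mult_left_mono) auto
      finally show ?thesis unfolding k_def[symmetric] k by simp
    qed (simp add: radial_modulus_supp)
  qed
  finally show "ennreal (cmod (deriv (sublinear_hilbert f) z)) \<le> (\<integral>\<^sup>+s. ennreal (radial_modulus f s * cmod (1 - of_real (1 - s) * z) powr - 2) \<partial>lborel)"
    using DERIV_imp_deriv[OF sublinear_hilbert_has_field_derivative[OF z]] by simp
qed (use f fin radial_modulus_measurable radial_modulus_nonneg radial_modulus_supp in auto)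

lemma sublinear_hilbert_at_0_le: "ennreal (cmod (sublinear_hilbert f 0)) \<le> (\<integral>\<^sup>+s. ennreal (radial_modulus f s) \<partial>lborel)"
  using cauchy_type_bound.U_le[OF sublinear_hilbert_bound, of 0] by simp

end

text \<open>Applied with \<beta> equal to 0, \<alpha> + 1 and \<alpha> + 1 - p, this places the
  three kinds of spaces in the domain of the operator.\<close>

lemma radial_modulus_L1:
  fixes p \<beta> :: real
  assumes p: "p > 1" and \<beta>: "\<beta> > -1" "\<beta> + 1 < p" and f: "f holomorphic_on ball 0 1"
    and fin: "(\<integral>\<^sup>+s\<in>{0<..}. ennreal (radial_modulus f s powr p * s powr \<beta>) \<partial>lborel) < \<infinity>"
  shows "(\<integral>\<^sup>+s. ennreal (radial_modulus f s) \<partial>lborel) < \<infinity>"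
proof -
  obtain C where W: "\<And>g a. g \<in> borel_measurable borel \<Longrightarrow> (\<And>s. 0 \<le> g s) \<Longrightarrow> (\<And>s. s \<notin> {0<..<1} \<Longrightarrow> g s = 0) \<Longrightarrow>
    a \<ge> 0 \<Longrightarrow> ennreal a \<le> (\<integral>\<^sup>+s. ennreal (g s) \<partial>lborel) \<Longrightarrow>
       ennreal (a powr p) \<le> ennreal C * (\<integral>\<^sup>+s\<in>{0<..}. ennreal (g s powr p * s powr \<beta>) \<partial>lborel)"
    using weighted_Lp_imp_L1[OF p \<beta>] by blast
  note * = W[OF radial_modulus_measurable[OF f] radial_modulus_nonneg radial_modulus_supp]
  show ?thesis
    by (rule nn_integral_finite_of_powr_bound[OF _ _ *]) (use p fin in \<open>auto simp: ennreal_mult_less_top\<close>)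
qed

section \<open>Boundedness on the three scales of spaces\<close>

text \<open>By continuity on a compact circle the real integral in \<open>integral_mean\<close>
  exists, so it can be traded for the extended one.\<close>

lemma circle_nn_integral_eq:
  fixes p :: real
  assumes f: "f holomorphic_on ball 0 1" and r: "0 \<le> r" "r < 1" and p: "p > 0"
  shows "(\<integral>\<^sup>+\<theta>\<in>{0..2*pi}. ennreal (cmod (f (rcis r \<theta>)) powr p) \<partial>lborel)
    = ennreal (2 * pi * integral_mean p r f powr p)"
proof -
  define L where "L = (LINT \<theta>:{0..2*pi}|lborel. cmod (f (rcis r \<theta>)) powr p)"
  have si: "set_integrable lborel {0..2*pi} (\<lambda>\<theta>. cmod (f (rcis r \<theta>)) powr p)"
    by (intro borel_integrable_atLeastAtMost' continuous_on_powr' continuous_intros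
          continuous_on_subset[OF continuous_on_circle[OF f r]]) (use p in auto)
  have "(\<integral>\<^sup>+\<theta>. ennreal (indicator {0..2*pi} \<theta> *\<^sub>R cmod (f (rcis r \<theta>)) powr p) \<partial>lborel) = ennreal L"
    unfolding L_def set_lebesgue_integral_def
    by (rule nn_integral_eq_integral) (use si in \<open>auto simp: set_integrable_def\<close>)
  moreover have "(\<integral>\<^sup>+\<theta>\<in>{0..2*pi}. ennreal (cmod (f (rcis r \<theta>)) powr p) \<partial>lborel)
    = (\<integral>\<^sup>+\<theta>. ennreal (indicator {0..2*pi} \<theta> *\<^sub>R cmod (f (rcis r \<theta>)) powr p) \<partial>lborel)"
    by (intro nn_integral_cong) (simp add: indicator_def)
  ultimately have 1: "(\<integral>\<^sup>+\<theta>\<in>{0..2*pi}. ennreal (cmod (f (rcis r \<theta>)) powr p) \<partial>lborel) = ennreal L"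
    by simp
  have "0 \<le> L" unfolding L_def set_lebesgue_integral_def by (intro integral_nonneg_AE) auto
  then have "2 * pi * integral_mean p r f powr p = L"
    using p by (simp add: integral_mean_def L_def powr_powr)
  with 1 show ?thesis by simp
qed

lemma integral_mean_nonneg: "0 \<le> integral_mean p r f"
  by (simp add: integral_mean_def)

lemma bergman_set_nn_integral:
  fixes p \<alpha> :: real
  assumes f: "f holomorphic_on ball 0 1" and p: "p > 0"
  shows "(\<lambda>z. indicator (ball 0 1) z *\<^sub>R (cmod (f z) powr p * (1 - (cmod z)\<^sup>2) powr \<alpha>)) \<in> borel_measurable borel"
    and "(\<integral>\<^sup>+z. ennreal (indicator (ball 0 1) z *\<^sub>R (cmod (f z) powr p * (1 - (cmod z)\<^sup>2) powr \<alpha>)) \<partial>lborel)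
      = bergman_nn_integral p \<alpha> f"
proof -
  define g where "g z = indicator (ball 0 1) z *\<^sub>R f z" for z
  have [measurable]: "g \<in> borel_measurable borel"
    unfolding g_def by (rule holomorphic_unit_disc_measurable[OF f])
  have "(\<lambda>z. cmod (g z) powr p * (1 - (cmod z)\<^sup>2) powr \<alpha>) \<in> borel_measurable borel" by measurable
  also have "(\<lambda>z. cmod (g z) powr p * (1 - (cmod z)\<^sup>2) powr \<alpha>)
    = (\<lambda>z. indicator (ball 0 1) z *\<^sub>R (cmod (f z) powr p * (1 - (cmod z)\<^sup>2) powr \<alpha>))"
    using p by (auto simp: g_def indicator_def fun_eq_iff)
  finally show "(\<lambda>z. indicator (ball 0 1) z *\<^sub>R (cmod (f z) powr p * (1 - (cmod z)\<^sup>2) powr \<alpha>)) \<in> borel_measurable borel" .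
  show "(\<integral>\<^sup>+z. ennreal (indicator (ball 0 1) z *\<^sub>R (cmod (f z) powr p * (1 - (cmod z)\<^sup>2) powr \<alpha>)) \<partial>lborel)
      = bergman_nn_integral p \<alpha> f"
    unfolding bergman_nn_integral_def by (intro nn_integral_cong) (simp add: indicator_def)
qed

lemma bergman_space_iff:
  fixes p \<alpha> :: real
  assumes p: "p > 0"
  shows "f \<in> bergman_space p \<alpha> \<longleftrightarrow> f holomorphic_on ball 0 1 \<and> bergman_nn_integral p \<alpha> f < \<infinity>"
proof (cases "f holomorphic_on ball 0 1")
  case True
  have "norm (indicator (ball 0 1) z *\<^sub>R (cmod (f z) powr p * (1 - (cmod z)\<^sup>2) powr \<alpha>))
    = indicator (ball 0 1) z *\<^sub>R (cmod (f z) powr p * (1 - (cmod z)\<^sup>2) powr \<alpha>)" for z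
    by (simp add: indicator_def)
  then show ?thesis
    using True bergman_set_nn_integral[OF True p, of \<alpha>]
    by (simp only: bergman_space_def set_integrable_def integrable_iff_bounded mem_Collect_eq measurable_lborel2 simp_thms)
qed (simp add: bergman_space_def)

lemma bergman_norm_eq:
  fixes p \<alpha> :: real
  assumes f: "f holomorphic_on ball 0 1" and p: "p > 0"
  shows "bergman_norm p \<alpha> f = ((\<alpha> + 1) / pi * enn2real (bergman_nn_integral p \<alpha> f)) powr (1 / p)"
proof -
  have "(LINT z:ball 0 1|lborel. cmod (f z) powr p * (1 - (cmod z)\<^sup>2) powr \<alpha>) = enn2real (bergman_nn_integral p \<alpha> f)"
    unfolding set_lebesgue_integral_def bergman_set_nn_integral(2)[OF f p, symmetric]
    by (rule integral_eq_nn_integral) (use bergman_set_nn_integral(1)[OF f p] in auto)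
  then show ?thesis by (simp add: bergman_norm_def mult.assoc)
qed

lemma sublinear_hilbert_bounded_hardy:
  fixes p :: real
  assumes p: "p > 1"
  shows "bounded_operator_on (hardy_space p) (hardy_norm p) sublinear_hilbert"
proof -
  obtain C where C: "C > 0" and rad: "\<And>f M. f holomorphic_on ball 0 1 \<Longrightarrow>
    (\<And>r. r\<in>{0<..<1} \<Longrightarrow> (\<integral>\<^sup>+\<theta>\<in>{0..2*pi}. ennreal (cmod (f (rcis r \<theta>)) powr p) \<partial>lborel) \<le> M) \<Longrightarrow>
    (\<integral>\<^sup>+s\<in>{0<..}. ennreal (radial_modulus f s powr p) \<partial>lborel) \<le> ennreal C * M"
    using hardy_radial_bound[OF p] by blast
  obtain D where D: "D > 0" and tar: "\<And>g U r. cauchy_type_bound g 1 U \<Longrightarrow> 0 \<le> r \<Longrightarrow> r < 1 \<Longrightarrow>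
    (\<integral>\<^sup>+\<theta>\<in>{0..2*pi}. ennreal (cmod (U (rcis r \<theta>)) powr p) \<partial>lborel)
      \<le> ennreal D * (\<integral>\<^sup>+s\<in>{0<..}. ennreal (g s powr p * s powr 0) \<partial>lborel)"
    using cauchy_type_hardy_bound[OF p] by blast
  \<comment> \<open>Both constants bound p-th powers, hence the root; the factors 2 pi of source and
    target cancel.\<close>
  define K where "K = (D * C) powr (1 / p)"
  have K: "K > 0" using C D by (simp add: K_def)
  show ?thesis
    unfolding bounded_operator_on_def
  proof (intro exI[of _ K] conjI ballI K)
    fix f assume "f \<in> hardy_space p"
    then have f: "f holomorphic_on ball 0 1" and bdd: "bdd_above ((\<lambda>r. integral_mean p r f) ` {0<..<1})"
      by (auto simp: hardy_space_def)
    let ?G = "sublinear_hilbert f"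
    define N where "N = hardy_norm p f"
    have mean_le: "integral_mean p r f \<le> N" if "r \<in> {0<..<1}" for r
      unfolding N_def hardy_norm_def by (rule cSUP_upper[OF that bdd])
    have N: "N \<ge> 0" using mean_le[of "1/2"] integral_mean_nonneg[of p "1/2" f] by simp
    have "(\<integral>\<^sup>+s\<in>{0<..}. ennreal (radial_modulus f s powr p) \<partial>lborel) \<le> ennreal C * ennreal (2 * pi * N powr p)"
    proof (rule rad[OF f])
      fix r :: real assume r: "r \<in> {0<..<1}"
      have "integral_mean p r f powr p \<le> N powr p"
        using p mean_le[OF r] integral_mean_nonneg by (intro powr_mono2) auto
      then show "(\<integral>\<^sup>+\<theta>\<in>{0..2*pi}. ennreal (cmod (f (rcis r \<theta>)) powr p) \<partial>lborel) \<le> ennreal (2 * pi * N powr p)"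
        using r p by (subst circle_nn_integral_eq[OF f]) (auto intro!: ennreal_leI)
    qed
    also have "(\<integral>\<^sup>+s\<in>{0<..}. ennreal (radial_modulus f s powr p) \<partial>lborel)
      = (\<integral>\<^sup>+s\<in>{0<..}. ennreal (radial_modulus f s powr p * s powr 0) \<partial>lborel)"
      by (intro nn_integral_cong) (simp add: indicator_def)
    finally have rad_le: "(\<integral>\<^sup>+s\<in>{0<..}. ennreal (radial_modulus f s powr p * s powr 0) \<partial>lborel) \<le> ennreal (C * (2 * pi * N powr p))"
      using C by (subst ennreal_mult) auto
    have fin: "(\<integral>\<^sup>+s. ennreal (radial_modulus f s) \<partial>lborel) < \<infinity>"
      by (rule radial_modulus_L1[OF p _ _ f, of 0]) (use p le_less_trans[OF rad_le] in auto)
    have G: "?G holomorphic_on ball 0 1" by (rule sublinear_hilbert_holomorphic[OF f fin])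
    have mean: "integral_mean p r ?G \<le> K * N" if r: "r \<in> {0<..<1}" for r
    proof -
      have "ennreal (2 * pi * integral_mean p r ?G powr p)
        = (\<integral>\<^sup>+\<theta>\<in>{0..2*pi}. ennreal (cmod (?G (rcis r \<theta>)) powr p) \<partial>lborel)"
        using r p by (intro circle_nn_integral_eq[OF G, symmetric]) auto
      also have "\<dots> \<le> ennreal D * ennreal (C * (2 * pi * N powr p))"
        using r by (intro order_trans[OF tar[OF sublinear_hilbert_bound[OF f fin]] mult_left_mono[OF rad_le]]) auto
      also have "\<dots> = ennreal (2 * pi * (D * C * N powr p))"
        using D C by (subst ennreal_mult[symmetric]) (auto simp: mult_ac)
      finally have "integral_mean p r ?G powr p \<le> D * C * N powr p"
        using D C by simp
      then have "(integral_mean p r ?G powr p) powr (1 / p) \<le> (D * C * N powr p) powr (1 / p)"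
        using p by (intro powr_mono2) auto
      then show ?thesis using p integral_mean_nonneg[of p r ?G] N C D by (simp add: powr_powr powr_mult K_def)
    qed
    then have "bdd_above ((\<lambda>r. integral_mean p r ?G) ` {0<..<1})" by (rule bdd_aboveI2)
    then show "?G \<in> hardy_space p" using G by (simp add: hardy_space_def)
    show "hardy_norm p ?G \<le> K * hardy_norm p f"
      unfolding hardy_norm_def[of p ?G] N_def[symmetric] by (rule cSUP_least[OF _ mean]) simp_all
  qed
qed

text \<open>Source and target estimates meet at the weight \<open>s powr (\<alpha> + 1)\<close> on
  the radius, since c = 1 leaves the exponent unchanged. The bound \<alpha> < p - 2 enters twice:
  for integrability along the radius and for the target estimate.\<close>

lemma sublinear_hilbert_bounded_bergman:
  fixes p \<alpha> :: real
  assumes p: "p > 1" and \<alpha>: "-1 < \<alpha>" "\<alpha> < p - 2"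
  shows "bounded_operator_on (bergman_space p \<alpha>) (bergman_norm p \<alpha>) sublinear_hilbert"
proof -
  obtain C where C: "C > 0" and rad: "\<And>f. f holomorphic_on ball 0 1 \<Longrightarrow>
    (\<integral>\<^sup>+s\<in>{0<..}. ennreal (radial_modulus f s powr p * s powr (\<alpha> + 1)) \<partial>lborel) \<le> ennreal C * bergman_nn_integral p \<alpha> f"
    using bergman_radial_bound[OF p \<alpha>(1)] by blast
  obtain D where D: "D > 0" and tar: "\<And>g U. cauchy_type_bound g 1 U \<Longrightarrow> U holomorphic_on ball 0 1 \<Longrightarrow>
    bergman_nn_integral p \<alpha> U \<le> ennreal D * (\<integral>\<^sup>+s\<in>{0<..}. ennreal (g s powr p * s powr (\<alpha> + 1 + p * (1 - 1))) \<partial>lborel)"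
    using cauchy_type_bergman_bound[OF p \<alpha>(1), of 1] \<alpha> by auto
  define K where "K = (D * C) powr (1 / p)"
  have K: "K > 0" using C D by (simp add: K_def)
  show ?thesis
    unfolding bounded_operator_on_def
  proof (intro exI[of _ K] conjI ballI K)
    fix f assume "f \<in> bergman_space p \<alpha>"
    then have f: "f holomorphic_on ball 0 1" and bf: "bergman_nn_integral p \<alpha> f < \<infinity>"
      using p by (auto simp: bergman_space_iff)
    let ?G = "sublinear_hilbert f"
    obtain b where b: "bergman_nn_integral p \<alpha> f = ennreal b" "b \<ge> 0"
      using bf by (cases "bergman_nn_integral p \<alpha> f") auto
    have fin: "(\<integral>\<^sup>+s. ennreal (radial_modulus f s) \<partial>lborel) < \<infinity>"
      by (rule radial_modulus_L1[OF p _ _ f, of "\<alpha> + 1"])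
         (use \<alpha> le_less_trans[OF rad[OF f]] bf in \<open>auto simp: ennreal_mult_less_top\<close>)
    have G: "?G holomorphic_on ball 0 1" by (rule sublinear_hilbert_holomorphic[OF f fin])
    have "bergman_nn_integral p \<alpha> ?G \<le> ennreal D * (\<integral>\<^sup>+s\<in>{0<..}. ennreal (radial_modulus f s powr p * s powr (\<alpha> + 1)) \<partial>lborel)"
      using tar[OF sublinear_hilbert_bound[OF f fin] G] by (simp only: diff_self mult_zero_right add_0_right)
    also have "\<dots> \<le> ennreal D * (ennreal C * ennreal b)"
      unfolding b(1)[symmetric] by (intro mult_left_mono rad f) auto
    also have "\<dots> = ennreal (D * C * b)"
      using C D b by (simp only: ennreal_mult[symmetric] mult.assoc mult_nonneg_nonneg less_imp_le)
    finally have le: "bergman_nn_integral p \<alpha> ?G \<le> ennreal (D * C * b)" .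
    then have "bergman_nn_integral p \<alpha> ?G < \<infinity>" by (rule le_less_trans) simp
    then show "?G \<in> bergman_space p \<alpha>" using p G by (simp add: bergman_space_iff)
    have "enn2real (bergman_nn_integral p \<alpha> ?G) \<le> D * C * b"
      using le C D b by (intro enn2real_leI) auto
    then have "((\<alpha> + 1) / pi * enn2real (bergman_nn_integral p \<alpha> ?G)) powr (1 / p) \<le> ((\<alpha> + 1) / pi * (D * C * b)) powr (1 / p)"
      using p \<alpha> by (intro powr_mono2 mult_left_mono) (auto intro!: mult_nonneg_nonneg)
    also have "\<dots> = K * ((\<alpha> + 1) / pi * b) powr (1 / p)"
      unfolding K_def using C D b \<alpha> by (subst powr_mult[symmetric]) (auto simp: mult_ac)
    finally show "bergman_norm p \<alpha> ?G \<le> K * bergman_norm p \<alpha> f"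
      using p b by (simp add: bergman_norm_eq[OF G] bergman_norm_eq[OF f])
  qed
qed

text \<open>All estimates meet at the weight \<beta> = \<alpha> + 1 - p on the radius. The two
  bounds on \<alpha> say exactly -1 < \<beta> < p - 1, and the upper one is also the condition
  \<alpha> + 2 < c p at c = 2.\<close>

lemma sublinear_hilbert_bounded_dirichlet:
  fixes p \<alpha> :: real
  assumes p: "p > 1" and \<alpha>: "p - 2 < \<alpha>" "\<alpha> < 2 * p - 2"
  shows "bounded_operator_on (dirichlet_space p \<alpha>) (dirichlet_norm p \<alpha>) sublinear_hilbert"
proof -
  define \<beta> where "\<beta> = \<alpha> + 1 - p"
  have \<beta>: "\<beta> > -1" "\<beta> + 1 < p" and \<alpha>1: "\<alpha> > -1" using p \<alpha> by (auto simp: \<beta>_def)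
  \<comment> \<open>Hardy's inequality asks for f' with the weight that the Bergman bound supplies;
    the estimate of the derivative with c = 2 comes back to \<beta>.\<close>
  have exps: "\<beta> + p = \<alpha> + 1" "\<alpha> + 1 + p * (1 - 2) = \<beta>" by (auto simp: \<beta>_def)
  obtain C1 where C1: "C1 > 0" and rad: "\<And>f. f holomorphic_on ball 0 1 \<Longrightarrow>
    (\<integral>\<^sup>+s\<in>{0<..}. ennreal (radial_modulus f s powr p * s powr (\<alpha> + 1)) \<partial>lborel) \<le> ennreal C1 * bergman_nn_integral p \<alpha> f"
    using bergman_radial_bound[OF p \<alpha>1] by blast
  obtain C2 where C2: "C2 > 0" and hardy: "\<And>f. f holomorphic_on ball 0 1 \<Longrightarrow>
    (\<integral>\<^sup>+s\<in>{0<..}. ennreal (radial_modulus f s powr p * s powr \<beta>) \<partial>lborel)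
      \<le> ennreal C2 * (ennreal (cmod (f 0) powr p) +
          (\<integral>\<^sup>+s\<in>{0<..}. ennreal (radial_modulus (deriv f) s powr p * s powr (\<alpha> + 1)) \<partial>lborel))"
    using radial_hardy_inequality[OF p \<beta>] unfolding exps by blast
  obtain C3 where C3: "C3 > 0" and L1: "\<And>g a. g \<in> borel_measurable borel \<Longrightarrow> (\<And>s. 0 \<le> g s) \<Longrightarrow> (\<And>s. s \<notin> {0<..<1} \<Longrightarrow> g s = 0) \<Longrightarrow>
    a \<ge> 0 \<Longrightarrow> ennreal a \<le> (\<integral>\<^sup>+s. ennreal (g s) \<partial>lborel) \<Longrightarrow>
       ennreal (a powr p) \<le> ennreal C3 * (\<integral>\<^sup>+s\<in>{0<..}. ennreal (g s powr p * s powr \<beta>) \<partial>lborel)"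
    using weighted_Lp_imp_L1[OF p \<beta>] by blast
  obtain C4 where C4: "C4 > 0" and tar: "\<And>g U. cauchy_type_bound g 2 U \<Longrightarrow> U holomorphic_on ball 0 1 \<Longrightarrow>
    bergman_nn_integral p \<alpha> U \<le> ennreal C4 * (\<integral>\<^sup>+s\<in>{0<..}. ennreal (g s powr p * s powr \<beta>) \<partial>lborel)"
    using cauchy_type_bergman_bound[OF p \<alpha>1, of 2] \<alpha> unfolding exps by auto
  define \<kappa> where "\<kappa> = (\<alpha> + 1) / pi"
  have \<kappa>: "\<kappa> > 0" using \<alpha>1 by (simp add: \<kappa>_def)
  \<comment> \<open>C3 controls the value at 0 and C4 the derivative. The maximum reflects that the
    norm weights |f(0)|^p with 1 but the area integral with \<kappa>.\<close>
  define M where "M = (C3 + \<kappa> * C4) * C2 * max 1 (C1 / \<kappa>)"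
  have M: "M > 0" using C1 C2 C3 C4 \<kappa> by (auto simp: M_def less_max_iff_disj add_pos_pos)
  define K where "K = M powr (1 / p)"
  have K: "K > 0" using M by (simp add: K_def)
  have norm_eq: "dirichlet_norm p \<alpha> f = (cmod (f 0) powr p + \<kappa> * enn2real (bergman_nn_integral p \<alpha> (deriv f))) powr (1 / p)"
    if "deriv f holomorphic_on ball 0 1" for f
    unfolding dirichlet_norm_def using p \<kappa> bergman_norm_eq[OF that, of p \<alpha>]
    by (simp add: powr_powr \<kappa>_def[symmetric])
  show ?thesis
    unfolding bounded_operator_on_def
  proof (intro exI[of _ K] conjI ballI K)
    fix f assume "f \<in> dirichlet_space p \<alpha>"
    then have f: "f holomorphic_on ball 0 1" and f': "deriv f holomorphic_on ball 0 1"
      and bf: "bergman_nn_integral p \<alpha> (deriv f) < \<infinity>"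
      using p by (auto simp: dirichlet_space_def bergman_space_iff)
    let ?G = "sublinear_hilbert f"
    obtain b where b: "bergman_nn_integral p \<alpha> (deriv f) = ennreal b" "b \<ge> 0"
      using bf by (cases "bergman_nn_integral p \<alpha> (deriv f)") auto
    define x where "x = cmod (f 0) powr p"
    define S where "S = C2 * (x + C1 * b)"
    have x: "x \<ge> 0" by (simp add: x_def)
    have S: "S \<ge> 0" using C2 C1 b x by (simp add: S_def)
    have "(\<integral>\<^sup>+s\<in>{0<..}. ennreal (radial_modulus f s powr p * s powr \<beta>) \<partial>lborel)
      \<le> ennreal C2 * (ennreal x + ennreal C1 * ennreal b)"
      unfolding x_def
      by (rule order_trans[OF hardy[OF f] mult_left_mono[OF add_left_mono[OF rad[OF f', unfolded b(1)]]]]) simp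
    also have "\<dots> = ennreal S"
    proof -
      have "ennreal C1 * ennreal b = ennreal (C1 * b)" using C1 b by (intro ennreal_mult[symmetric]) auto
      moreover have "ennreal x + ennreal (C1 * b) = ennreal (x + C1 * b)" using x C1 b by (intro ennreal_plus[symmetric]) auto
      moreover have "ennreal C2 * ennreal (x + C1 * b) = ennreal S"
        unfolding S_def using x C1 C2 b by (intro ennreal_mult[symmetric]) auto
      ultimately show ?thesis by simp
    qed
    finally have rad_le: "(\<integral>\<^sup>+s\<in>{0<..}. ennreal (radial_modulus f s powr p * s powr \<beta>) \<partial>lborel) \<le> ennreal S" .
    have fin: "(\<integral>\<^sup>+s. ennreal (radial_modulus f s) \<partial>lborel) < \<infinity>"
      by (rule radial_modulus_L1[OF p \<beta> f le_less_trans[OF rad_le]]) simp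
    have G: "?G holomorphic_on ball 0 1" by (rule sublinear_hilbert_holomorphic[OF f fin])
    then have G': "deriv ?G holomorphic_on ball 0 1" by (intro holomorphic_deriv) auto
    have "bergman_nn_integral p \<alpha> (deriv ?G) \<le> ennreal C4 * ennreal S"
      by (rule order_trans[OF tar[OF deriv_sublinear_hilbert_bound[OF f fin] G'] mult_left_mono[OF rad_le]]) simp
    also have "\<dots> = ennreal (C4 * S)" using C4 S by (intro ennreal_mult[symmetric]) auto
    finally have le: "bergman_nn_integral p \<alpha> (deriv ?G) \<le> ennreal (C4 * S)" .
    then have "bergman_nn_integral p \<alpha> (deriv ?G) < \<infinity>" by (rule le_less_trans) simp
    then show "?G \<in> dirichlet_space p \<alpha>" using p G G' by (simp add: dirichlet_space_def bergman_space_iff)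
    have le': "enn2real (bergman_nn_integral p \<alpha> (deriv ?G)) \<le> C4 * S"
      using le C4 S by (intro enn2real_leI) auto
    \<comment> \<open>At z = 0 the kernel is 1, so the value of the operator there is bounded by the
      L1 norm of f along the radius.\<close>
    have "ennreal (cmod (?G 0) powr p) \<le> ennreal C3 * (\<integral>\<^sup>+s\<in>{0<..}. ennreal (radial_modulus f s powr p * s powr \<beta>) \<partial>lborel)"
      by (rule L1[OF radial_modulus_measurable[OF f] radial_modulus_nonneg radial_modulus_supp])
         (use sublinear_hilbert_at_0_le[OF f fin] in auto)
    also have "\<dots> \<le> ennreal C3 * ennreal S" by (intro mult_left_mono rad_le) auto
    also have "\<dots> = ennreal (C3 * S)" using C3 S by (intro ennreal_mult[symmetric]) auto
    finally have G0: "cmod (?G 0) powr p \<le> C3 * S" using C3 S by simp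
    have "x + C1 * b \<le> max 1 (C1 / \<kappa>) * x + max 1 (C1 / \<kappa>) * (\<kappa> * b)"
    proof (intro add_mono)
      show "x \<le> max 1 (C1 / \<kappa>) * x" using x mult_right_mono[of 1 "max 1 (C1 / \<kappa>)" x] by simp
      have "C1 * b = C1 / \<kappa> * (\<kappa> * b)" using \<kappa> by simp
      also have "\<dots> \<le> max 1 (C1 / \<kappa>) * (\<kappa> * b)" using \<kappa> b by (intro mult_right_mono) auto
      finally show "C1 * b \<le> max 1 (C1 / \<kappa>) * (\<kappa> * b)" .
    qed
    then have SM: "(C3 + \<kappa> * C4) * S \<le> M * (x + \<kappa> * b)"
      unfolding S_def M_def mult.assoc using C2 C3 C4 \<kappa> 
      by (intro mult_left_mono) (auto simp: distrib_left)
    have "cmod (?G 0) powr p + \<kappa> * enn2real (bergman_nn_integral p \<alpha> (deriv ?G)) \<le> C3 * S + \<kappa> * (C4 * S)"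
      using \<kappa> by (intro add_mono G0 mult_left_mono le') auto
    also have "\<dots> = (C3 + \<kappa> * C4) * S" by (simp add: algebra_simps)
    also note SM
    finally have "dirichlet_norm p \<alpha> ?G \<le> (M * (x + \<kappa> * b)) powr (1 / p)"
      unfolding norm_eq[OF G'] using p \<kappa> by (intro powr_mono2) auto
    also have "\<dots> = K * dirichlet_norm p \<alpha> f"
      unfolding norm_eq[OF f'] K_def using M x \<kappa> b by (simp add: powr_mult x_def)
    finally show "dirichlet_norm p \<alpha> ?G \<le> K * dirichlet_norm p \<alpha> f" .
  qed
qed

theorem theorem5:
  fixes p \<alpha> :: real
  assumes "p > 1"
  shows "bounded_operator_on (hardy_space p) (hardy_norm p) sublinear_hilbert \<and>
    (-1 < \<alpha> \<and> \<alpha> < p - 2 \<longrightarrow>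
       bounded_operator_on (bergman_space p \<alpha>) (bergman_norm p \<alpha>) sublinear_hilbert) \<and>
    (p - 2 < \<alpha> \<and> \<alpha> \<le> p - 1 \<longrightarrow>
       bounded_operator_on (dirichlet_space p \<alpha>) (dirichlet_norm p \<alpha>) sublinear_hilbert)"
proof (intro conjI impI)
  show "bounded_operator_on (hardy_space p) (hardy_norm p) sublinear_hilbert"
    by (rule sublinear_hilbert_bounded_hardy[OF assms])
  show "bounded_operator_on (bergman_space p \<alpha>) (bergman_norm p \<alpha>) sublinear_hilbert"
    if "-1 < \<alpha> \<and> \<alpha> < p - 2"
    using sublinear_hilbert_bounded_bergman[OF assms] that by simp
  show "bounded_operator_on (dirichlet_space p \<alpha>) (dirichlet_norm p \<alpha>) sublinear_hilbert"
    if "p - 2 < \<alpha> \<and> \<alpha> \<le> p - 1"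
    \<comment> \<open>For p > 1 one has p - 1 < 2 p - 2, so the closed endpoint \<alpha> = p - 1
      lies inside the open range.\<close>
    by (rule sublinear_hilbert_bounded_dirichlet[OF assms]) (use that assms in linarith)+
qed

end
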